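(* Let $(\mathbf X_m,\mathbf y_m)$, $m=1,\dots,T$, with $\mathbf X_m\in\mathbb R^{n_m\times d}$, $\mathbf y_m\in\mathbb R^{n_m}$, be jointly realizable regression tasks, let $\mathbf w_\star$ be the minimum-norm joint solution, $R=\max_{m}\|\mathbf X_m\|$ and $\bar r=\frac1T\sum_{m=1}^T\operatorname{rank}(\mathbf X_m)$. Let $\tau$ be a random task ordering without replacement and let $\mathbf w_0,\dots,\mathbf w_k$ be the iterates of continual linear regression learned to convergence (equivalently, of the block Kaczmarz method). Then for every $k\in\{2,\dots,T\}$, both $\mathbb E_\tau[\mathcal L(\mathbf w_k)]$ and $\mathbb E_\tau[F_\tau(k)]$ are at most $$\min\left(\frac{7}{\sqrt[4]{k-1}},\ \frac{d-\bar r+1}{k-1}\right)\|\mathbf w_\star\|^2R^2 .$$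
   Context: Notation: $\|\cdot\|$ is the Euclidean norm for vectors and the spectral norm for matrices; $\mathbf X^+$ is the Moore--Penrose pseudo-inverse. Joint realizability: the set $\mathcal W_\star=\{\mathbf w\in\mathbb R^d:\mathbf X_m\mathbf w=\mathbf y_m\ \forall m\in\{1,\dots,T\}\}$ is nonempty. $\mathbf w_\star=\operatorname{argmin}_{\mathbf w\in\mathcal W_\star}\|\mathbf w\|$. Random task ordering without replacement: $\tau(1),\dots,\tau(k)$ are drawn uniformly from $\{1,\dots,T\}$ without replacement (the first $k$ entries of a uniformly random permutation of $\{1,\dots,T\}$). Iterates: $\mathbf w_0=\mathbf 0$; at iteration $t$ the learner starts from $\mathbf w_{t-1}$ and minimizes the loss $\mathcal L_{\tau(t)}(\mathbf w)=\frac12\|\mathbf X_{\tau(t)}\mathbf w-\mathbf y_{\tau(t)}\|^2$ by gradient descent to convergence, yielding $\mathbf w_t$. Explicitly (block Kaczmarz update), $\mathbf w_t=\mathbf w_{t-1}-\mathbf X_{\tau(t)}^+(\mathbf X_{\tau(t)}\mathbf w_{t-1}-\mathbf y_{\tau(t)})$. Training loss: $\mathcal L(\mathbf w)=\frac1{2T}\sum_{m=1}^T\|\mathbf X_m\mathbf w-\mathbf y_m\|^2$. Forgetting: $F_\tau(k)=\frac1{2k}\sum_{t=1}^k\|\mathbf X_{\tau(t)}\mathbf w_k-\mathbf y_{\tau(t)}\|^2$. *)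

theory Defs
  imports "HOL-Probability.Probability" "HOL-Combinatorics.Permutations"
    "Jordan_Normal_Form.DL_Rank"
begin

definition vnorm :: "real Matrix.vec \<Rightarrow> real" where
  "vnorm v = sqrt (scalar_prod v v)"

text \<open>The closed unit ball, rather than the unit sphere, keeps the supremum over a nonempty set
  for matrices without columns.\<close>

definition spectral_norm :: "real mat \<Rightarrow> real" where
  "spectral_norm A = (SUP v\<in>{v \<in> carrier_vec (dim_col A). vnorm v \<le> 1}. vnorm (A *\<^sub>v v))"

definition mat_rank :: "real mat \<Rightarrow> nat" where
  "mat_rank A = vec_space.rank (dim_row A) A"

text \<open>The four Penrose conditions, which determine \<open>P\<close> uniquely.\<close>

definition is_pinv :: "real mat \<Rightarrow> real mat \<Rightarrow> bool" where
  "is_pinv A P \<longleftrightarrow>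
     P \<in> carrier_mat (dim_col A) (dim_row A) \<and>
     A * P * A = A \<and> P * A * P = P \<and>
     transpose_mat (A * P) = A * P \<and> transpose_mat (P * A) = P * A"

definition pinv :: "real mat \<Rightarrow> real mat" where
  "pinv A = (THE P. is_pinv A P)"

text \<open>Below, \<open>d\<close> is the dimension of the parameter space, the tasks are
  \<open>(X 1, y 1), \<dots>, (X T, y T)\<close>, and \<open>\<tau> t\<close> is the task learned at iteration \<open>t\<close>.\<close>

definition joint_solutions ::
    "nat \<Rightarrow> nat \<Rightarrow> (nat \<Rightarrow> real mat) \<Rightarrow> (nat \<Rightarrow> real Matrix.vec) \<Rightarrow> real Matrix.vec set" where
  "joint_solutions d T X y = {w \<in> carrier_vec d. \<forall>m\<in>{1..T}. X m *\<^sub>v w = y m}"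

definition min_norm_solution ::
    "nat \<Rightarrow> nat \<Rightarrow> (nat \<Rightarrow> real mat) \<Rightarrow> (nat \<Rightarrow> real Matrix.vec) \<Rightarrow> real Matrix.vec" where
  "min_norm_solution d T X y = (ARG_MIN vnorm w. w \<in> joint_solutions d T X y)"

text \<open>Gradient descent on the loss of one task, started at \<open>w\<close> and run to convergence, ends in the
  point given by the block Kaczmarz update.\<close>

primrec iterate ::
    "nat \<Rightarrow> (nat \<Rightarrow> real mat) \<Rightarrow> (nat \<Rightarrow> real Matrix.vec) \<Rightarrow> (nat \<Rightarrow> nat) \<Rightarrow> nat \<Rightarrow> real Matrix.vec" where
  "iterate d X y \<tau> 0 = 0\<^sub>v d"
| "iterate d X y \<tau> (Suc t) =
     (let w = iterate d X y \<tau> t; m = \<tau> (Suc t)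
      in w - pinv (X m) *\<^sub>v (X m *\<^sub>v w - y m))"

definition training_loss ::
    "nat \<Rightarrow> (nat \<Rightarrow> real mat) \<Rightarrow> (nat \<Rightarrow> real Matrix.vec) \<Rightarrow> real Matrix.vec \<Rightarrow> real" where
  "training_loss T X y w = 1 / (2 * real T) * (\<Sum>m=1..T. (vnorm (X m *\<^sub>v w - y m))\<^sup>2)"

definition forgetting ::
    "nat \<Rightarrow> (nat \<Rightarrow> real mat) \<Rightarrow> (nat \<Rightarrow> real Matrix.vec) \<Rightarrow> (nat \<Rightarrow> nat) \<Rightarrow> nat \<Rightarrow> real" where
  "forgetting d X y \<tau> k =
     1 / (2 * real k) *
       (\<Sum>t=1..k. (vnorm (X (\<tau> t) *\<^sub>v iterate d X y \<tau> k - y (\<tau> t)))\<^sup>2)"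

definition random_ordering :: "nat \<Rightarrow> (nat \<Rightarrow> nat) pmf" where
  "random_ordering T = pmf_of_set {\<tau>. \<tau> permutes {1..T}}"

end

theory Submission
  imports Defs
begin

text \<open>
  The errors \<open>e t = w t - wstar\<close> satisfy \<open>e t = P (\<tau> t) (e (t - 1))\<close> with the orthogonal projections
  \<open>P m = 1 - pinv (X m) X m\<close>, and a loss is at most \<open>R\<^sup>2\<close> times a squared residual \<open>\<parallel>e - P m e\<parallel>\<^sup>2\<close>.
  Let \<open>g j\<close> be the expected squared residual of \<open>e j\<close> for the next task, which by exchangeability
  is that for any task not yet seen. Expanding \<open>\<parallel>e t - e j\<parallel>\<^sup>2\<close> along the steps \<open>t = j, \<dots>, k\<close>
  gives \<open>g j + \<dots> + g k \<le> 4 (k - j + 1) g j\<close>; together with \<open>g 0 + \<dots> + g k \<le> \<parallel>wstar\<parallel>\<^sup>2\<close>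
  this forces \<open>g k\<close> to decay like the inverse fourth root of \<open>k\<close>.
  The Frobenius analogue of \<open>g\<close>, with the product of the projections in place of \<open>e j\<close>, is
  nonincreasing and telescopes to at most the mean of \<open>d - rank (X m)\<close>, which gives the
  dimension-dependent rate.
  For a task already seen, deleting its step changes \<open>e k\<close> by at most the residual of that step
  and makes the task a fresh one; the squared residuals of all steps sum to at most \<open>\<parallel>wstar\<parallel>\<^sup>2\<close>.
\<close>

unbundle no vec_syntax
unbundle no inner_syntax

section \<open>Norms\<close>

definition sqn :: "real Matrix.vec \<Rightarrow> real" where
  "sqn v = v \<bullet> v"

text \<open>The squared Frobenius norm; like \<open>sqn\<close> it is quadratic, so it adds up over
  columns and obeys Pythagoras without square roots.\<close>

definition frob :: "real mat \<Rightarrow> real" where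
  "frob A = (\<Sum>i<dim_row A. \<Sum>j<dim_col A. (A $$ (i, j))\<^sup>2)"

lemma sqn_sum: "sqn v = (\<Sum>i<dim_vec v. (v $ i)\<^sup>2)"
  by (simp add: sqn_def scalar_prod_def power2_eq_square atLeast0LessThan)

lemma sqn_nonneg [simp]: "0 \<le> sqn v"
  by (simp add: sqn_sum sum_nonneg)

lemma vnorm_sqn: "vnorm v = sqrt (sqn v)"
  by (simp add: vnorm_def sqn_def)

lemma vnorm_power2 [simp]: "(vnorm v)\<^sup>2 = sqn v"
  by (simp add: vnorm_sqn)

lemma vnorm_nonneg [simp]: "0 \<le> vnorm v"
  by (simp add: vnorm_sqn)

lemma sqn_eq_0_iff: "v \<in> carrier_vec n \<Longrightarrow> sqn v = 0 \<longleftrightarrow> v = 0\<^sub>v n"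
  by (auto simp: sqn_sum sum_nonneg_eq_0_iff)

lemma sqn_uminus [simp]: "sqn (- v) = sqn v"
  by (simp add: sqn_sum)

lemma sqn_add:
  assumes "v \<in> carrier_vec n" "w \<in> carrier_vec n"
  shows "sqn (v + w) = sqn v + sqn w + 2 * (v \<bullet> w)"
  using assms by (simp add: sqn_sum scalar_prod_def atLeast0LessThan power2_sum sum.distrib
      sum_distrib_left mult.assoc)

lemma sqn_diff:
  assumes "v \<in> carrier_vec n" "w \<in> carrier_vec n"
  shows "sqn (v - w) = sqn v + sqn w - 2 * (v \<bullet> w)"
  using assms by (simp add: sqn_sum scalar_prod_def atLeast0LessThan power2_diff sum.distrib
      sum_subtractf sum_distrib_left mult.assoc)

lemma sqn_add_le:
  assumes "v \<in> carrier_vec n" "w \<in> carrier_vec n"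
  shows "sqn (v + w) \<le> 2 * sqn v + 2 * sqn w"
  using sqn_add[OF assms] sqn_diff[OF assms] sqn_nonneg[of "v - w"] by simp

lemma sqn_diff_commute:
  assumes "v \<in> carrier_vec n" "w \<in> carrier_vec n"
  shows "sqn (v - w) = sqn (w - v)"
  using assms by (simp add: sqn_sum power2_commute)

lemma frob_nonneg [simp]: "0 \<le> frob A"
  by (simp add: frob_def sum_nonneg)

lemma frob_cols: "frob A = (\<Sum>j<dim_col A. sqn (col A j))"
  by (simp add: frob_def sqn_sum) (rule sum.swap)

lemma frob_transpose: "frob (transpose_mat A) = frob A"
  by (simp add: frob_def) (rule sum.swap)

lemma mult_mat_vec_index_sum:
  assumes "A \<in> carrier_mat m n" "v \<in> carrier_vec n" "i < m"
  shows "(A *\<^sub>v v) $ i = (\<Sum>j<n. A $$ (i, j) * v $ j)"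
  using assms by (simp add: scalar_prod_def atLeast0LessThan)

text \<open>Cauchy-Schwarz row by row. It makes the supremum in \<open>spectral_norm\<close> finite
  and later bounds residuals of vectors by Frobenius norms.\<close>

lemma sqn_mult_mat_vec_le:
  assumes "A \<in> carrier_mat m n" "v \<in> carrier_vec n"
  shows "sqn (A *\<^sub>v v) \<le> frob A * sqn v"
proof -
  have "((A *\<^sub>v v) $ i)\<^sup>2 \<le> (\<Sum>j<n. (A $$ (i, j))\<^sup>2) * sqn v" if "i < m" for i
    using Cauchy_Schwarz_ineq_sum[of "\<lambda>j. A $$ (i, j)" "\<lambda>j. v $ j" "{..<n}"] assms
      mult_mat_vec_index_sum[OF assms that] by (simp add: sqn_sum)
  then have "sqn (A *\<^sub>v v) \<le> (\<Sum>i<m. (\<Sum>j<n. (A $$ (i, j))\<^sup>2) * sqn v)"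
    using assms by (subst sqn_sum) (auto intro!: sum_mono)
  then show ?thesis
    using assms by (simp add: frob_def sum_distrib_right)
qed

text \<open>The supremum of an unbounded set of reals carries no information, so the bound
  \<open>sqrt (frob A)\<close> is supplied first.\<close>

lemma spectral_norm_bdd:
  "bdd_above ((\<lambda>v. vnorm (A *\<^sub>v v)) ` {v \<in> carrier_vec (dim_col A). vnorm v \<le> 1})"
proof (intro bdd_aboveI2)
  fix v assume v: "v \<in> {v \<in> carrier_vec (dim_col A). vnorm v \<le> 1}"
  then have "sqn v \<le> 1" by (simp add: vnorm_sqn)
  have "sqn (A *\<^sub>v v) \<le> frob A * sqn v"
    using v by (intro sqn_mult_mat_vec_le) auto
  also have "\<dots> \<le> frob A"
    using \<open>sqn v \<le> 1\<close> mult_left_le frob_nonneg by blast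
  finally show "vnorm (A *\<^sub>v v) \<le> sqrt (frob A)"
    by (simp add: vnorm_sqn)
qed

lemma spectral_norm_nonneg: "0 \<le> spectral_norm A"
proof -
  have "vnorm (A *\<^sub>v 0\<^sub>v (dim_col A)) \<le> spectral_norm A"
    unfolding spectral_norm_def
    by (intro cSUP_upper spectral_norm_bdd) (simp add: vnorm_sqn sqn_def)
  then show ?thesis using vnorm_nonneg order_trans by blast
qed

lemma sqn_smult: "sqn (c \<cdot>\<^sub>v v) = c\<^sup>2 * sqn v"
  by (simp add: sqn_sum power_mult_distrib sum_distrib_left)

lemma vnorm_mult_le:
  assumes "A \<in> carrier_mat m n" "v \<in> carrier_vec n"
  shows "vnorm (A *\<^sub>v v) \<le> spectral_norm A * vnorm v"
proof (cases "v = 0\<^sub>v n")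
  case True
  have "A *\<^sub>v 0\<^sub>v n = 0\<^sub>v m" using assms by auto
  then show ?thesis using True by (simp add: vnorm_sqn sqn_def)
next
  case False
  then have pos: "vnorm v > 0"
    using sqn_eq_0_iff[OF assms(2)] sqn_nonneg[of v] by (simp add: vnorm_sqn less_le)
  define u where "u = (1 / vnorm v) \<cdot>\<^sub>v v"
  have u: "u \<in> carrier_vec n" using assms by (simp add: u_def)
  have "sqn u = 1" using pos by (simp add: u_def sqn_smult power_divide del: vnorm_power2 flip: vnorm_power2[of v])
  then have "vnorm (A *\<^sub>v u) \<le> spectral_norm A"
    unfolding spectral_norm_def using u assms
    by (intro cSUP_upper spectral_norm_bdd) (simp add: vnorm_sqn)
  moreover have "A *\<^sub>v u = (1 / vnorm v) \<cdot>\<^sub>v (A *\<^sub>v v)"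
    unfolding u_def by (rule mult_mat_vec[OF assms])
  ultimately have "vnorm (A *\<^sub>v v) / vnorm v \<le> spectral_norm A"
    using pos by (simp add: vnorm_sqn sqn_smult real_sqrt_mult)
  then show ?thesis using pos by (simp add: field_simps)
qed

lemma sqn_mult_le_spectral_norm:
  assumes "A \<in> carrier_mat m n" "v \<in> carrier_vec n"
  shows "sqn (A *\<^sub>v v) \<le> (spectral_norm A)\<^sup>2 * sqn v"
  using power_mono[OF vnorm_mult_le[OF assms], of 2] by (simp add: power_mult_distrib)

section \<open>Moore--Penrose inverse and orthogonal projections\<close>

text \<open>\<open>B\<close> consists of a maximal independent set of columns of \<open>A\<close>,
  and \<open>C\<close> holds the coordinates of all columns of \<open>A\<close> in that basis.
  \<open>E\<close> picks the columns of \<open>A\<close> that form \<open>B\<close>; this later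
  yields a right inverse of \<open>C\<close> without a second rank argument.\<close>

lemma rank_factorization:
  fixes A :: "real mat"
  assumes A: "A \<in> carrier_mat m n"
  obtains B C E where "B \<in> carrier_mat m (mat_rank A)" "C \<in> carrier_mat (mat_rank A) n"
    "E \<in> carrier_mat n (mat_rank A)" "A = B * C" "A * E = B"
    "\<And>v. v \<in> carrier_vec (mat_rank A) \<Longrightarrow> B *\<^sub>v v = 0\<^sub>v m \<Longrightarrow> v = 0\<^sub>v (mat_rank A)"
proof -
  interpret vec_space "TYPE(real)" m .
  obtain S where S: "maximal S (\<lambda>T. T \<subseteq> set (cols A) \<and> lin_indpt T)" "finite S"
    using maximal_exists_superset[of "set (cols A)" "\<lambda>T. T \<subseteq> set (cols A) \<and> lin_indpt T" "{}"]
      finite_lin_indpt2[of "{}"] by auto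
  have S': "S \<subseteq> set (cols A)" "lin_indpt S" using S(1) by (auto simp: maximal_def)
  have cA: "set (cols A) \<subseteq> carrier_vec m" using A cols_dim by blast
  then have Sc: "S \<subseteq> carrier_vec m" using S' by blast
  obtain ss where ss: "set ss = S" "distinct ss" using S(2) finite_distinct_list by blast
  define r where "r = length ss"
  have rank: "mat_rank A = r"
    using rank_card_indpt[OF A S(1)] A ss distinct_card[of ss] by (simp add: mat_rank_def r_def)
  define B where "B = mat_of_cols m ss"
  have B: "B \<in> carrier_mat m r" by (simp add: B_def r_def)
  have colsB: "cols B = ss" using ss Sc by (simp add: B_def)
  have inj: "v = 0\<^sub>v r" if "v \<in> carrier_vec r" "B *\<^sub>v v = 0\<^sub>v m" for v
    using lin_depI[OF B that(1) _ that(2)] colsB ss S' by auto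
  have "\<exists>g \<in> carrier_vec r. B *\<^sub>v g = col A j" if j: "j < n" for j
  proof -
    have cj: "col A j \<in> set (cols A)" using j A by (metis carrier_matD(2) cols_length cols_nth nth_mem)
    then have cc: "col A j \<in> carrier_vec m" using cA by blast
    \<comment> \<open>A column outside the span could be added to \<open>S\<close>, against
      maximality.\<close>
    have "col A j \<in> span S"
    proof (rule ccontr)
      assume n: "col A j \<notin> span S"
      then have nS: "col A j \<notin> S" using Sc span_mem by blast
      have "lin_indpt (S \<union> {col A j})"
        using lin_dep_iff_in_span[of S "col A j"] n nS Sc cc S' by auto
      then have "S \<union> {col A j} = S"
        using S(1) cj S'(1) unfolding maximal_def by (metis Un_upper1 Un_subset_iff empty_subsetI insert_subset)
      then show False using nS by blast
    qed
    then have "col A j \<in> span_list ss" using span_list_as_span[of ss] ss Sc by simp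
    then obtain f where "col A j = lincomb_list f ss" by (auto elim: in_span_listE)
    also have "\<dots> = B *\<^sub>v vec r f"
      unfolding B_def r_def using ss Sc by (intro lincomb_list_as_mat_mult) auto
    finally show ?thesis by (intro bexI[of _ "vec r f"]) auto
  qed
  then obtain g where g: "\<And>j. j < n \<Longrightarrow> g j \<in> carrier_vec r" "\<And>j. j < n \<Longrightarrow> B *\<^sub>v g j = col A j"
    by metis
  define C where "C = mat r n (\<lambda>(i, j). g j $ i)"
  have C: "C \<in> carrier_mat r n" by (simp add: C_def)
  have "col C j = g j" if "j < n" for j
    using g(1)[OF that] that by (auto simp: C_def)
  then have BC: "A = B * C"
  proof (intro mat_col_eqI)
    fix i assume "i < dim_col (B * C)"
    then have "i < n" using C by simp
    then show "col A i = col (B * C) i"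
      using \<open>\<And>j. j < n \<Longrightarrow> col C j = g j\<close> g(2) col_mult2[OF B C] by metis
  qed (use A B C in auto)
  have "\<exists>h. h < n \<and> col A h = ss ! i" if "i < r" for i
    using that S' ss A by (metis carrier_matD(2) cols_length cols_nth in_set_conv_nth nth_mem r_def subsetD)
  then obtain h where h: "\<And>i. i < r \<Longrightarrow> h i < n" "\<And>i. i < r \<Longrightarrow> col A (h i) = ss ! i"
    by metis
  define E where "E = mat n r (\<lambda>(a, i). if a = h i then 1 else 0 :: real)"
  have E: "E \<in> carrier_mat n r" by (simp add: E_def)
  have "A * E = B"
  proof (rule eq_matI)
    fix a i assume "a < dim_row B" "i < dim_col B"
    then have ai: "a < m" "i < r" using B by auto
    have "(A * E) $$ (a, i) = (\<Sum>k\<in>{0..<n}. A $$ (a, k) * (if k = h i then 1 else 0))"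
      using ai A E by (simp add: scalar_prod_def E_def)
    also have "\<dots> = A $$ (a, h i)" using h(1)[OF ai(2)] by (simp add: if_distrib sum.delta cong: if_cong)
    also have "\<dots> = col A (h i) $ a" using h(1)[OF ai(2)] ai A by simp
    also have "\<dots> = B $$ (a, i)" using h(2) ai by (simp add: B_def mat_of_cols_index r_def)
    finally show "(A * E) $$ (a, i) = B $$ (a, i)" .
  qed (use A E B in auto)
  then show thesis
    using that[unfolded rank, OF B C E BC _ inj] by blast
qed

lemma sqn_mult_gram:
  assumes "A \<in> carrier_mat m n" "v \<in> carrier_vec n"
  shows "v \<bullet> (transpose_mat A *\<^sub>v (A *\<^sub>v v)) = sqn (A *\<^sub>v v)"
proof -
  have c: "A *\<^sub>v v \<in> carrier_vec m" using assms by simp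
  have "v \<bullet> (transpose_mat A *\<^sub>v (A *\<^sub>v v)) = (transpose_mat A *\<^sub>v (A *\<^sub>v v)) \<bullet> v"
    using assms c by (intro comm_scalar_prod) auto
  then show ?thesis
    using transpose_vec_mult_scalar[OF assms c] by (simp add: sqn_def)
qed

text \<open>The quadratic form of the Gram matrix is \<open>sqn (B *\<^sub>v v)\<close>, so
  injectivity of \<open>B\<close> passes to it and makes it invertible. The inverse is symmetric
  because its transpose is a left inverse too.\<close>

lemma gram_inverse:
  fixes B :: "real mat"
  assumes B: "B \<in> carrier_mat m r"
    and inj: "\<And>v. v \<in> carrier_vec r \<Longrightarrow> B *\<^sub>v v = 0\<^sub>v m \<Longrightarrow> v = 0\<^sub>v r"
  obtains G where "G \<in> carrier_mat r r" "G * (transpose_mat B * B) = 1\<^sub>m r"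
    "(transpose_mat B * B) * G = 1\<^sub>m r" "transpose_mat G = G"
proof -
  define D where "D = transpose_mat B * B"
  have D: "D \<in> carrier_mat r r" using B by (simp add: D_def)
  have DT: "transpose_mat D = D"
    using transpose_mult[of "transpose_mat B" r m B r] B by (simp add: D_def)
  have "v = 0\<^sub>v r" if v: "v \<in> carrier_vec r" "D *\<^sub>v v = 0\<^sub>v r" for v
  proof -
    have "sqn (B *\<^sub>v v) = v \<bullet> (D *\<^sub>v v)"
      using sqn_mult_gram[OF B v(1)] v B by (simp add: D_def assoc_mult_mat_vec[of _ r m])
    then have "sqn (B *\<^sub>v v) = 0" using v by simp
    then show ?thesis using inj[OF v(1)] sqn_eq_0_iff[of "B *\<^sub>v v" m] B v by simp
  qed
  then have "det D \<noteq> 0" using det_0_iff_vec_prod_zero_field[OF D] by blast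
  then have "D \<in> Units (ring_mat TYPE(real) r ())" by (rule det_non_zero_imp_unit[OF D])
  then obtain G where G: "G \<in> carrier_mat r r" "G * D = 1\<^sub>m r" "D * G = 1\<^sub>m r"
    by (auto simp: Units_def ring_mat_def)
  have "transpose_mat G * D = 1\<^sub>m r"
    using transpose_mult[OF D G(1)] G(3) DT by simp
  then have "transpose_mat G = transpose_mat G * (D * G)" using G by simp
  also have "\<dots> = (transpose_mat G * D) * G" using G D by (simp add: assoc_mult_mat[of _ r r _ r _ r])
  also have "\<dots> = G" using G \<open>transpose_mat G * D = 1\<^sub>m r\<close> by simp
  finally show thesis using that[of G] G by (simp add: D_def)
qed

section \<open>Trace, and uniqueness and existence of the pseudo-inverse\<close>

definition mtrace :: "real mat \<Rightarrow> real" where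
  "mtrace A = (\<Sum>i<dim_row A. A $$ (i, i))"

lemma mtrace_mult_commute:
  assumes "A \<in> carrier_mat m n" "B \<in> carrier_mat n m"
  shows "mtrace (A * B) = mtrace (B * A)"
proof -
  have "mtrace (A * B) = (\<Sum>i<m. \<Sum>j<n. A $$ (i, j) * B $$ (j, i))"
    using assms by (simp add: mtrace_def scalar_prod_def atLeast0LessThan)
  also have "\<dots> = (\<Sum>j<n. \<Sum>i<m. B $$ (j, i) * A $$ (i, j))"
    by (subst sum.swap) (simp add: mult.commute)
  also have "\<dots> = mtrace (B * A)"
    using assms by (simp add: mtrace_def scalar_prod_def atLeast0LessThan)
  finally show ?thesis .
qed

lemma mtrace_one [simp]: "mtrace (1\<^sub>m n) = real n"
  by (simp add: mtrace_def)

text \<open>First \<open>A * Q\<close> and \<open>Q * A\<close> are shown to be the same for all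
  pseudo-inverses \<open>Q\<close>, by transposing \<open>A * Q = (A * Q') * (A * Q)\<close> and its
  mirror image; then \<open>P = P * A * P\<close> turns into \<open>P' * A * P'\<close>.\<close>

lemma is_pinv_unique:
  assumes P: "is_pinv A P" and P': "is_pinv A P'"
  shows "P = P'"
proof -
  define m n where "m = dim_row A" and "n = dim_col A"
  have A: "A \<in> carrier_mat m n" by (simp add: m_def n_def)
  have c: "P \<in> carrier_mat n m" "P' \<in> carrier_mat n m"
    using P P' by (auto simp: is_pinv_def m_def n_def)
  have sub: "A * Q = A * Q' \<and> Q * A = Q' * A" if "is_pinv A Q" "is_pinv A Q'" for Q Q'
  proof -
    have c: "Q \<in> carrier_mat n m" "Q' \<in> carrier_mat n m"
      using that by (auto simp: is_pinv_def m_def n_def)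
    note * = that[unfolded is_pinv_def]
    have "A * Q = (A * Q' * A) * Q" using * by simp
    also have "\<dots> = (A * Q') * (A * Q)"
      using A c by (intro assoc_mult_mat[of _ m m]) auto
    finally have "transpose_mat (A * Q) = transpose_mat (A * Q) * transpose_mat (A * Q')"
      using transpose_mult[of "A * Q'" m m "A * Q" m] A c by simp
    then have "A * Q = (A * Q) * (A * Q')" using * by simp
    also have "\<dots> = (A * Q * A) * Q'"
      using A c by (intro assoc_mult_mat[symmetric, of _ m m]) auto
    finally have 1: "A * Q = A * Q'" using * by simp
    have "Q * A = Q * (A * Q' * A)" using * by simp
    also have "A * Q' * A = A * (Q' * A)"
      using A c by (intro assoc_mult_mat) auto
    also have "Q * (A * (Q' * A)) = (Q * A) * (Q' * A)"
      using A c by (intro assoc_mult_mat[symmetric, of _ n m]) auto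
    finally have "transpose_mat (Q * A) = transpose_mat (Q' * A) * transpose_mat (Q * A)"
      using transpose_mult[of "Q * A" n n "Q' * A" n] A c by simp
    then have "Q * A = (Q' * A) * (Q * A)" using * by simp
    also have "\<dots> = Q' * (A * (Q * A))"
      using A c by (intro assoc_mult_mat[of _ n m]) auto
    also have "A * (Q * A) = A * Q * A"
      using A c by (intro assoc_mult_mat[symmetric]) auto
    finally show ?thesis using 1 * by simp
  qed
  have "P = (P * A) * P" using P by (simp add: is_pinv_def)
  also have "\<dots> = P' * (A * P)"
    using sub[OF P P'] A c by (simp add: assoc_mult_mat[of P' n m A n P m])
  also have "\<dots> = (P' * A) * P'"
    using sub[OF P P'] A c by (simp add: assoc_mult_mat[of P' n m A n P' m])
  also have "\<dots> = P'" using P' by (simp add: is_pinv_def)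
  finally show ?thesis .
qed

text \<open>The inner pairs \<open>L * B\<close> and \<open>C * R\<close> cancel, which leaves
  \<open>B * L\<close> and \<open>R * C\<close> as the two products that have to be
  symmetric.\<close>

lemma is_pinv_factorization:
  assumes B: "B \<in> carrier_mat m r" and C: "C \<in> carrier_mat r n"
    and L: "L \<in> carrier_mat r m" and R: "R \<in> carrier_mat n r"
    and LB: "L * B = 1\<^sub>m r" and CR: "C * R = 1\<^sub>m r"
    and BL: "transpose_mat (B * L) = B * L" and RC: "transpose_mat (R * C) = R * C"
  shows "is_pinv (B * C) (R * L)" and "R * L * (B * C) = R * C"
proof -
  have 1: "B * C * (R * L) = B * L"
  proof -
    have "B * C * (R * L) = B * (C * (R * L))"
      using B C R L by (intro assoc_mult_mat[of _ m r _ n _ m]) auto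
    also have "C * (R * L) = (C * R) * L"
      using C R L by (intro assoc_mult_mat[symmetric]) auto
    finally show ?thesis using CR L by simp
  qed
  show 2: "R * L * (B * C) = R * C"
  proof -
    have "R * L * (B * C) = R * (L * (B * C))"
      using B C R L by (intro assoc_mult_mat[of _ n r _ m _ n]) auto
    also have "L * (B * C) = (L * B) * C"
      using C B L by (intro assoc_mult_mat[symmetric]) auto
    finally show ?thesis using LB C by simp
  qed
  have 3: "B * C * (R * L) * (B * C) = B * C"
  proof -
    have "B * L * (B * C) = B * (L * (B * C))"
      using B C L by (intro assoc_mult_mat[of _ m r _ m _ n]) auto
    also have "L * (B * C) = (L * B) * C"
      using C B L by (intro assoc_mult_mat[symmetric]) auto
    finally show ?thesis using LB C 1 by simp
  qed
  have 4: "R * L * (B * C) * (R * L) = R * L"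
  proof -
    have "R * C * (R * L) = R * (C * (R * L))"
      using R C L by (intro assoc_mult_mat[of _ n r _ n _ m]) auto
    also have "C * (R * L) = (C * R) * L"
      using C R L by (intro assoc_mult_mat[symmetric]) auto
    finally show ?thesis using CR L 2 by simp
  qed
  show "is_pinv (B * C) (R * L)"
    using 1 2 3 4 BL RC B C L R by (simp add: is_pinv_def)
qed

text \<open>For a rank factorization \<open>A = B * C\<close> the pseudo-inverse is
  \<open>R * L\<close>, with the least-squares left inverse \<open>L\<close> of \<open>B\<close> and
  the minimum-norm right inverse \<open>R\<close> of \<open>C\<close>. The trace is the rank because
  \<open>R * C\<close> and \<open>C * R = 1\<^sub>m r\<close> have equal trace.\<close>

lemma pinv_exists:
  fixes A :: "real mat"
  assumes A: "A \<in> carrier_mat m n"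
  shows "is_pinv A (pinv A) \<and> mtrace (pinv A * A) = real (mat_rank A)"
proof -
  define r where "r = mat_rank A"
  obtain B C E where B: "B \<in> carrier_mat m r" and C: "C \<in> carrier_mat r n"
    and E: "E \<in> carrier_mat n r" and ABC: "A = B * C" and AE: "A * E = B"
    and inj: "\<And>v. v \<in> carrier_vec r \<Longrightarrow> B *\<^sub>v v = 0\<^sub>v m \<Longrightarrow> v = 0\<^sub>v r"
    using rank_factorization[OF A] unfolding r_def by metis
  obtain G where G: "G \<in> carrier_mat r r" "G * (transpose_mat B * B) = 1\<^sub>m r" "transpose_mat G = G"
    using gram_inverse[OF B inj] by metis
  define L where "L = G * transpose_mat B"
  have L: "L \<in> carrier_mat r m" using G B by (simp add: L_def)
  have LB: "L * B = 1\<^sub>m r"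
    using G B by (simp add: L_def assoc_mult_mat[of G r r _ m B r])
  have "transpose_mat (B * L) = transpose_mat L * transpose_mat B"
    using B L by (rule transpose_mult)
  also have "transpose_mat L = B * G"
    using transpose_mult[of G r r "transpose_mat B" m] G B by (simp add: L_def)
  also have "B * G * transpose_mat B = B * L"
    using G B by (simp add: L_def assoc_mult_mat[of B m r G r _ m])
  finally have BL: "transpose_mat (B * L) = B * L" .
  \<comment> \<open>\<open>B * (C * E) = A * E = B\<close>, and \<open>L\<close> cancels
    \<open>B\<close> from the left.\<close>
  have CE: "C * E = 1\<^sub>m r"
  proof -
    have "C * E = (L * B) * (C * E)" using C E by (simp add: LB)
    also have "\<dots> = L * (B * (C * E))" using L B C E by (intro assoc_mult_mat[of _ r m _ r _ r]) auto
    also have "B * (C * E) = B * C * E" using B C E by (intro assoc_mult_mat[symmetric]) auto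
    also have "L * (B * C * E) = 1\<^sub>m r" using AE ABC LB by simp
    finally show ?thesis .
  qed
  have CT: "transpose_mat C \<in> carrier_mat n r" using C by simp
  have injC: "v = 0\<^sub>v r" if v: "v \<in> carrier_vec r" "transpose_mat C *\<^sub>v v = 0\<^sub>v n" for v
  proof -
    have "v = transpose_mat (C * E) *\<^sub>v v" using v by (simp add: CE)
    also have "\<dots> = (transpose_mat E * transpose_mat C) *\<^sub>v v"
      using transpose_mult[OF C E] by simp
    also have "\<dots> = transpose_mat E *\<^sub>v (transpose_mat C *\<^sub>v v)"
      using E C v by (intro assoc_mult_mat_vec[of _ r n _ r]) auto
    also have "\<dots> = 0\<^sub>v r" using v E by auto
    finally show ?thesis .
  qed
  obtain H where H: "H \<in> carrier_mat r r" "C * transpose_mat C * H = 1\<^sub>m r" "transpose_mat H = H"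
    using gram_inverse[OF CT injC] by (metis transpose_transpose)
  define R where "R = transpose_mat C * H"
  have R: "R \<in> carrier_mat n r" using H C by (simp add: R_def)
  have "C * R = C * transpose_mat C * H"
    unfolding R_def using H C by (intro assoc_mult_mat[symmetric]) auto
  then have CR: "C * R = 1\<^sub>m r" using H by simp
  have "transpose_mat (R * C) = transpose_mat C * transpose_mat R"
    using R C by (rule transpose_mult)
  also have "transpose_mat R = H * C"
    using transpose_mult[of "transpose_mat C" n r H r] H C by (simp add: R_def)
  also have "transpose_mat C * (H * C) = R * C"
    using H C by (simp add: R_def assoc_mult_mat[of _ n r H r C n])
  finally have RC: "transpose_mat (R * C) = R * C" .
  note * = is_pinv_factorization[OF B C L R LB CR BL RC]
  have "pinv A = R * L"
    unfolding pinv_def using * is_pinv_unique ABC by (intro the_equality) auto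
  moreover have "mtrace (R * C) = real r"
    using mtrace_mult_commute[OF R C] CR by simp
  ultimately show ?thesis using * ABC by (simp add: r_def)
qed

lemmas is_pinv_pinv = pinv_exists[THEN conjunct1]
  and mtrace_pinv = pinv_exists[THEN conjunct2]

lemma pinv_carrier [simp]: "A \<in> carrier_mat m n \<Longrightarrow> pinv A \<in> carrier_mat n m"
  using is_pinv_pinv[of A m n] by (auto simp: is_pinv_def)

lemma pinv_mult_carrier [simp]: "A \<in> carrier_mat m n \<Longrightarrow> pinv A * A \<in> carrier_mat n n"
  using mult_carrier_mat[OF pinv_carrier] .

section \<open>Orthogonal projections and Pythagoras\<close>

definition orth_proj :: "nat \<Rightarrow> real mat \<Rightarrow> bool" where
  "orth_proj d P \<longleftrightarrow> P \<in> carrier_mat d d \<and> transpose_mat P = P \<and> P * P = P"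

lemma orth_proj_one: "orth_proj d (1\<^sub>m d)"
  by (simp add: orth_proj_def)

lemma orth_proj_carrier: "orth_proj d P \<Longrightarrow> P \<in> carrier_mat d d"
  by (simp add: orth_proj_def)

lemma orth_proj_complement:
  assumes "orth_proj d P"
  shows "orth_proj d (1\<^sub>m d - P)"
proof -
  have P: "P \<in> carrier_mat d d" "transpose_mat P = P" "P * P = P"
    using assms by (auto simp: orth_proj_def)
  have "(1\<^sub>m d - P) * (1\<^sub>m d - P) = (1\<^sub>m d - P) * 1\<^sub>m d - (1\<^sub>m d - P) * P"
    using P by (intro mult_minus_distrib_mat[of _ d d]) auto
  also have "(1\<^sub>m d - P) * P = 0\<^sub>m d d"
    using P minus_mult_distrib_mat[of "1\<^sub>m d" d d P P d] by simp
  finally have "(1\<^sub>m d - P) * (1\<^sub>m d - P) = 1\<^sub>m d - P" using P by auto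
  moreover have "transpose_mat (1\<^sub>m d - P) = 1\<^sub>m d - P"
    using P transpose_minus[of "1\<^sub>m d" d d P] by simp
  ultimately show ?thesis using P minus_carrier_mat[OF P(1)] by (simp add: orth_proj_def)
qed

lemma orth_proj_pinv_mult:
  assumes A: "A \<in> carrier_mat m n"
  shows "orth_proj n (pinv A * A)"
proof -
  have P: "is_pinv A (pinv A)" using is_pinv_pinv[OF A] .
  have "pinv A * A * (pinv A * A) = pinv A * A * pinv A * A"
    using A by (intro assoc_mult_mat[symmetric, of _ n n _ m _ n]) auto
  then show ?thesis using P A by (simp add: orth_proj_def is_pinv_def)
qed

lemma orth_proj_inner:
  assumes "orth_proj d P" "v \<in> carrier_vec d"
  shows "v \<bullet> (P *\<^sub>v v) = sqn (P *\<^sub>v v)"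
proof -
  have P: "P \<in> carrier_mat d d" "transpose_mat P = P" "P * P = P"
    using assms by (auto simp: orth_proj_def)
  have "P *\<^sub>v (P *\<^sub>v v) = P *\<^sub>v v"
    using assoc_mult_mat_vec[OF P(1) P(1) assms(2)] P by simp
  then show ?thesis using sqn_mult_gram[OF P(1) assms(2)] P by simp
qed

lemma sqn_minus_proj:
  assumes "orth_proj d P" "v \<in> carrier_vec d"
  shows "sqn (v - P *\<^sub>v v) = sqn v - sqn (P *\<^sub>v v)"
  using sqn_diff[of v d "P *\<^sub>v v"] orth_proj_inner[OF assms] orth_proj_carrier[OF assms(1)] assms(2)
  by simp

lemma frob_minus_proj:
  assumes P: "orth_proj d P" and A: "A \<in> carrier_mat d n"
  shows "frob (A - P * A) = frob A - frob (P * A)"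
proof -
  have Pc: "P \<in> carrier_mat d d" using P by (rule orth_proj_carrier)
  have "sqn (col (A - P * A) j) = sqn (col A j) - sqn (col (P * A) j)" if "j < n" for j
  proof -
    have "col (A - P * A) j = col A j - P *\<^sub>v col A j"
      using that A Pc col_mult2[OF Pc A that] by (auto simp: minus_mat_def)
    then show ?thesis
      using sqn_minus_proj[OF P, of "col A j"] col_mult2[OF Pc A that] A
      by (metis carrier_matD(1) col_dim)
  qed
  then show ?thesis using A Pc by (simp add: frob_cols sum_subtractf)
qed

lemma frob_orth_proj:
  assumes "orth_proj d P"
  shows "frob P = mtrace P"
proof -
  have P: "P \<in> carrier_mat d d" "transpose_mat P = P" "P * P = P"
    using assms by (auto simp: orth_proj_def)
  have sym: "P $$ (j, i) = P $$ (i, j)" if "i < d" "j < d" for i j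
    using P that by (metis carrier_matD index_transpose_mat(1))
  have "mtrace (P * P) = (\<Sum>i<d. \<Sum>j<d. P $$ (i, j) * P $$ (j, i))"
    using P(1) by (simp add: mtrace_def scalar_prod_def atLeast0LessThan)
  also have "\<dots> = frob P"
    using P(1) by (simp add: frob_def power2_eq_square sym)
  finally show ?thesis using P by simp
qed

text \<open>Transposing moves the projection to the left of the matrix, where
  \<open>frob_minus_proj\<close> applies.\<close>

lemma frob_mult_proj_le:
  assumes P: "orth_proj d P" and A: "A \<in> carrier_mat n d"
  shows "frob (A * P) \<le> frob A"
proof -
  have Pc: "P \<in> carrier_mat d d" using P by (rule orth_proj_carrier)
  have "frob (A * P) = frob (P * transpose_mat A)"
    using transpose_mult[OF A Pc] P by (simp add: orth_proj_def flip: frob_transpose[of "A * P"])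
  also have "\<dots> \<le> frob (transpose_mat A)"
    using frob_minus_proj[OF P, of "transpose_mat A" n] A frob_nonneg
    by (metis diff_ge_0_iff_ge transpose_carrier_mat)
  finally show ?thesis by (simp add: frob_transpose)
qed

text \<open>For a projection the squared Frobenius norm is the trace, and the trace of
  \<open>pinv A * A\<close> is the rank. The term \<open>d - rbar\<close> of the final bound
  originates here.\<close>

lemma frob_complement_pinv:
  assumes A: "A \<in> carrier_mat m n"
  shows "frob (1\<^sub>m n - pinv A * A) = real n - real (mat_rank A)"
proof -
  have complement: "mtrace (1\<^sub>m n - P) = real n - mtrace P" if "P \<in> carrier_mat n n" for P
    using that by (simp add: mtrace_def sum_subtractf)
  have "frob (1\<^sub>m n - pinv A * A) = mtrace (1\<^sub>m n - pinv A * A)"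
    by (rule frob_orth_proj[OF orth_proj_complement[OF orth_proj_pinv_mult[OF A]]])
  then show ?thesis
    using complement[OF pinv_mult_carrier[OF A]] mtrace_pinv[OF A] by simp
qed

section \<open>Existence of the minimum-norm joint solution\<close>

lemma ex_common_gram:
  fixes X :: "nat \<Rightarrow> real mat"
  assumes X: "\<And>m. m \<in> M \<Longrightarrow> X m \<in> carrier_mat (n m) d" and "finite M"
  obtains S where "S \<in> carrier_mat d d"
    "\<And>v. v \<in> carrier_vec d \<Longrightarrow> S *\<^sub>v v = 0\<^sub>v d \<longleftrightarrow> (\<forall>m\<in>M. X m *\<^sub>v v = 0\<^sub>v (n m))"
proof -
  \<comment> \<open>The sum of the Gram matrices: its quadratic form is the sum of all
    \<open>sqn (X m *\<^sub>v v)\<close>, so one kernel encodes all systems and a single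
    pseudo-inverse can be used.\<close>
  define S where "S = mat d d (\<lambda>(i, j). \<Sum>m\<in>M. (transpose_mat (X m) * X m) $$ (i, j))"
  have S: "S \<in> carrier_mat d d" by (simp add: S_def)
  have Sv: "(S *\<^sub>v v) $ i = (\<Sum>m\<in>M. (transpose_mat (X m) *\<^sub>v (X m *\<^sub>v v)) $ i)"
    if v: "v \<in> carrier_vec d" and i: "i < d" for v i
  proof -
    have "(S *\<^sub>v v) $ i = (\<Sum>j<d. (\<Sum>m\<in>M. (transpose_mat (X m) * X m) $$ (i, j)) * v $ j)"
      using v i by (simp add: S_def scalar_prod_def atLeast0LessThan)
    also have "\<dots> = (\<Sum>m\<in>M. \<Sum>j<d. (transpose_mat (X m) * X m) $$ (i, j) * v $ j)"
      by (subst sum.swap) (simp add: sum_distrib_right)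
    also have "\<dots> = (\<Sum>m\<in>M. ((transpose_mat (X m) * X m) *\<^sub>v v) $ i)"
    proof (rule sum.cong[OF refl])
      fix m assume "m \<in> M"
      then have "transpose_mat (X m) * X m \<in> carrier_mat d d"
        using X[of m] by (intro mult_carrier_mat[of _ d "n m"]) auto
      then show "(\<Sum>j<d. (transpose_mat (X m) * X m) $$ (i, j) * v $ j)
          = ((transpose_mat (X m) * X m) *\<^sub>v v) $ i"
        using mult_mat_vec_index_sum v i by metis
    qed
    also have "\<dots> = (\<Sum>m\<in>M. (transpose_mat (X m) *\<^sub>v (X m *\<^sub>v v)) $ i)"
    proof (rule sum.cong[OF refl])
      fix m assume "m \<in> M"
      then show "((transpose_mat (X m) * X m) *\<^sub>v v) $ i = (transpose_mat (X m) *\<^sub>v (X m *\<^sub>v v)) $ i"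
        using assoc_mult_mat_vec[of "transpose_mat (X m)" d "n m" "X m" d v] X v by simp
    qed
    finally show ?thesis .
  qed
  have "S *\<^sub>v v = 0\<^sub>v d \<longleftrightarrow> (\<forall>m\<in>M. X m *\<^sub>v v = 0\<^sub>v (n m))" if v: "v \<in> carrier_vec d" for v
  proof
    assume 0: "S *\<^sub>v v = 0\<^sub>v d"
    have "v \<bullet> (S *\<^sub>v v) = (\<Sum>i<d. v $ i * (\<Sum>m\<in>M. (transpose_mat (X m) *\<^sub>v (X m *\<^sub>v v)) $ i))"
      using S v by (simp add: scalar_prod_def[of v] atLeast0LessThan Sv[OF v] del: index_mult_mat_vec)
    also have "\<dots> = (\<Sum>m\<in>M. \<Sum>i<d. v $ i * (transpose_mat (X m) *\<^sub>v (X m *\<^sub>v v)) $ i)"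
      by (subst sum.swap) (simp add: sum_distrib_left)
    also have "\<dots> = (\<Sum>m\<in>M. v \<bullet> (transpose_mat (X m) *\<^sub>v (X m *\<^sub>v v)))"
    proof (rule sum.cong[OF refl])
      fix m assume "m \<in> M"
      then have "dim_vec (transpose_mat (X m) *\<^sub>v (X m *\<^sub>v v)) = d" using X by auto
      then show "(\<Sum>i<d. v $ i * (transpose_mat (X m) *\<^sub>v (X m *\<^sub>v v)) $ i)
          = v \<bullet> (transpose_mat (X m) *\<^sub>v (X m *\<^sub>v v))"
        by (simp only: scalar_prod_def[of v] atLeast0LessThan)
    qed
    also have "\<dots> = (\<Sum>m\<in>M. sqn (X m *\<^sub>v v))"
      using sqn_mult_gram[OF X v] by (intro sum.cong) auto
    finally have "(\<Sum>m\<in>M. sqn (X m *\<^sub>v v)) = 0" using 0 v by simp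
    then have "\<forall>m\<in>M. sqn (X m *\<^sub>v v) = 0"
      using \<open>finite M\<close> by (simp add: sum_nonneg_eq_0_iff)
    then show "\<forall>m\<in>M. X m *\<^sub>v v = 0\<^sub>v (n m)"
      using X v sqn_eq_0_iff by (metis mult_mat_vec_carrier)
  next
    assume 0: "\<forall>m\<in>M. X m *\<^sub>v v = 0\<^sub>v (n m)"
    have "transpose_mat (X m) *\<^sub>v 0\<^sub>v (n m) = 0\<^sub>v d" if "m \<in> M" for m
      using X[OF that] by auto
    then show "S *\<^sub>v v = 0\<^sub>v d"
      using S 0 by (intro eq_vecI) (simp_all add: Sv[OF v] del: index_mult_mat_vec)
  qed
  then show thesis using that S by blast
qed

text \<open>\<open>ARG_MIN\<close> says nothing unless a minimiser exists. One is
  \<open>Q *\<^sub>v w\<close> for any solution \<open>w\<close>, where \<open>Q\<close> is the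
  orthogonal projection that annihilates the common kernel of the \<open>X m\<close>: all solutions
  have the same image under \<open>Q\<close>, and \<open>Q\<close> does not increase norms.\<close>

lemma min_norm_solution_mem:
  fixes X :: "nat \<Rightarrow> real mat"
  assumes X: "\<And>m. m \<in> {1..T} \<Longrightarrow> X m \<in> carrier_mat (n m) d"
    and ne: "joint_solutions d T X y \<noteq> {}"
  shows "min_norm_solution d T X y \<in> joint_solutions d T X y"
proof -
  obtain S where S: "S \<in> carrier_mat d d"
    and ker: "\<And>v. v \<in> carrier_vec d \<Longrightarrow>
      S *\<^sub>v v = 0\<^sub>v d \<longleftrightarrow> (\<forall>m\<in>{1..T}. X m *\<^sub>v v = 0\<^sub>v (n m))"
    using ex_common_gram[of "{1..T}" X n d] X by blast
  have eq_iff: "S *\<^sub>v v = S *\<^sub>v w \<longleftrightarrow> (\<forall>m\<in>{1..T}. X m *\<^sub>v v = X m *\<^sub>v w)"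
    if v: "v \<in> carrier_vec d" and w: "w \<in> carrier_vec d" for v w
  proof -
    have *: "A *\<^sub>v v = A *\<^sub>v w \<longleftrightarrow> A *\<^sub>v (v - w) = 0\<^sub>v k" if A: "A \<in> carrier_mat k d" for A :: "real mat" and k
    proof -
      have "A *\<^sub>v (v - w) = A *\<^sub>v v - A *\<^sub>v w" using A v w by (rule mult_minus_distrib_mat_vec)
      moreover have "A *\<^sub>v v - A *\<^sub>v w = 0\<^sub>v k \<longleftrightarrow> A *\<^sub>v v = A *\<^sub>v w"
        using A v w minus_add_minus_vec
        by (auto simp: vec_eq_iff simp del: index_mult_mat_vec)
      ultimately show ?thesis by simp
    qed
    show ?thesis using *[OF S] *[OF X] ker[of "v - w"] v w by simp
  qed
  obtain w where w: "w \<in> joint_solutions d T X y" using ne by blast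
  then have wc: "w \<in> carrier_vec d" by (simp add: joint_solutions_def)
  define Q where "Q = pinv S * S"
  have Q: "orth_proj d Q" unfolding Q_def by (rule orth_proj_pinv_mult[OF S])
  have Qc: "Q \<in> carrier_mat d d" using Q by (rule orth_proj_carrier)
  have "S * Q = S * pinv S * S"
    unfolding Q_def using S by (intro assoc_mult_mat[symmetric]) auto
  then have "S * Q = S" using is_pinv_pinv[OF S] by (simp add: is_pinv_def)
  then have "S *\<^sub>v (Q *\<^sub>v w) = S *\<^sub>v w" using assoc_mult_mat_vec[OF S Qc wc] by simp
  then have "\<forall>m\<in>{1..T}. X m *\<^sub>v (Q *\<^sub>v w) = X m *\<^sub>v w" using eq_iff Qc wc by simp
  then have sol: "Q *\<^sub>v w \<in> joint_solutions d T X y"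
    using w Qc by (auto simp: joint_solutions_def)
  have le: "vnorm (Q *\<^sub>v w) \<le> vnorm w'" if w': "w' \<in> joint_solutions d T X y" for w'
  proof -
    have w'c: "w' \<in> carrier_vec d" using w' by (simp add: joint_solutions_def)
    have "S *\<^sub>v w' = S *\<^sub>v w" using eq_iff[OF w'c wc] w w' by (simp add: joint_solutions_def)
    then have "Q *\<^sub>v w' = Q *\<^sub>v w"
      using S wc w'c by (simp add: Q_def assoc_mult_mat_vec[of "pinv S" d d S d])
    then have "sqn (Q *\<^sub>v w) \<le> sqn w'"
      using sqn_minus_proj[OF Q w'c] sqn_nonneg[of "w' - Q *\<^sub>v w'"] by simp
    then show ?thesis by (simp add: vnorm_sqn)
  qed
  show ?thesis
    unfolding min_norm_solution_def
    by (rule arg_minI[where x = "Q *\<^sub>v w"]) (use sol le in \<open>auto simp: not_less\<close>)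
qed

section \<open>Last-iterate decay\<close>

lemma root_4_ge:
  fixes x y :: real
  assumes "0 \<le> x" "x ^ 4 \<le> y"
  shows "x \<le> root 4 y"
  using real_root_le_mono[of 4 "x ^ 4" y] assms by (simp add: real_root_power_cancel)

text \<open>After taking fourth powers, \<open>exp\<close> separates the two sides: \<open>(1 - 1 /
  (4 * m)) ^ 4 \<le> exp (- 1 / m) \<le> 1 / (1 + 1 / m)\<close>. The coefficient 1/4 is what
  produces the fourth root.\<close>

lemma one_minus_quarter_le_root:
  fixes m :: real
  assumes "1 \<le> m"
  shows "1 - 1 / (4 * m) \<le> root 4 (m / (m + 1))"
proof (rule root_4_ge)
  show "0 \<le> 1 - 1 / (4 * m)" using assms by (simp add: field_simps)
  have "(1 - 1 / (4 * m)) ^ 4 \<le> exp (- (1 / (4 * m))) ^ 4"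
    using exp_ge_add_one_self[of "- (1 / (4 * m))"] assms
    by (intro power_mono) (auto simp: field_simps)
  also have "\<dots> = inverse (exp (1 / m))"
    using exp_of_nat_mult[of 4 "- (1 / (4 * m))"] assms by (simp add: exp_minus)
  also have "\<dots> \<le> inverse (1 + 1 / m)"
    using exp_ge_add_one_self[of "1 / m"] assms by (intro le_imp_inverse_le) (auto simp: field_simps)
  also have "\<dots> = m / (m + 1)" using assms by (simp add: field_simps)
  finally show "(1 - 1 / (4 * m)) ^ 4 \<le> m / (m + 1)" .
qed

text \<open>With the suffix sums \<open>s j\<close> the hypothesis reads \<open>s (j + 1) \<le> (1 - 1 / (4 * m)) * s j\<close>, where
  \<open>m = k - j + 1\<close>; the product of these factors decays like the fourth root.\<close>

lemma last_term_le_root_sum: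
  fixes g :: "nat \<Rightarrow> real"
  assumes suffix: "\<And>j. j \<le> k \<Longrightarrow> (\<Sum>t=j..k. g t) \<le> 4 * (real k - real j + 1) * g j"
    and nonneg: "\<And>j. 0 \<le> g j"
  shows "g k \<le> root 4 (2 / (real k + 2)) * (\<Sum>t\<le>k. g t)"
proof -
  define s where "s j = (\<Sum>t=j..k. g t)" for j
  \<comment> \<open>The factors \<open>root 4 (m / (m + 1))\<close> telescope; at
    \<open>j = k\<close> the numerator is 2 and the suffix sum is the single term
    \<open>g k\<close>.\<close>
  have "s j \<le> root 4 ((real k - real j + 2) / (real k + 2)) * s 0" if "j \<le> k" for j
    using that
  proof (induction j)
    case 0
    then show ?case by simp
  next
    case (Suc j)
    define m where "m = real k - real j + 1"
    have m: "m \<ge> 1" using Suc.prems by (simp add: m_def)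
    have s: "s j = g j + s (Suc j)" using Suc.prems by (simp add: s_def sum.atLeast_Suc_atMost)
    have "s j / (4 * m) \<le> g j"
      using suffix[of j] Suc.prems m by (simp add: s_def m_def field_simps)
    then have "s (Suc j) \<le> (1 - 1 / (4 * m)) * s j"
      using s by (simp add: algebra_simps)
    also have "\<dots> \<le> root 4 (m / (m + 1)) * s j"
      using one_minus_quarter_le_root[OF m] nonneg by (intro mult_right_mono) (auto simp: s_def sum_nonneg)
    also have "\<dots> \<le> root 4 (m / (m + 1)) * (root 4 ((m + 1) / (real k + 2)) * s 0)"
      using Suc m by (intro mult_left_mono) (auto simp: m_def add_ac real_root_ge_zero)
    also have "\<dots> = root 4 (m / (real k + 2)) * s 0"
      using m by (simp flip: real_root_mult mult.assoc)
    finally show ?case by (simp add: m_def algebra_simps)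
  qed
  from this[of k] show ?thesis by (simp add: s_def atLeast0AtMost)
qed

section \<open>One projection step seen from an arbitrary point\<close>

lemma orth_proj_orthogonal:
  assumes "orth_proj d P" and u: "u \<in> carrier_vec d" and z: "z \<in> carrier_vec d"
  shows "(P *\<^sub>v u) \<bullet> (z - P *\<^sub>v z) = 0"
proof -
  have P: "P \<in> carrier_mat d d" "transpose_mat P = P" "P * P = P"
    using assms by (auto simp: orth_proj_def)
  have zc: "z - P *\<^sub>v z \<in> carrier_vec d" using P z by simp
  have "P *\<^sub>v (z - P *\<^sub>v z) = P *\<^sub>v z - (P * P) *\<^sub>v z"
    using P z mult_minus_distrib_mat_vec[of P d d z "P *\<^sub>v z"] assoc_mult_mat_vec[OF P(1) P(1) z] by simp
  also have "\<dots> = 0\<^sub>v d" using P z minus_cancel_vec[of "P *\<^sub>v z" d] by simp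
  finally have "P *\<^sub>v (z - P *\<^sub>v z) = 0\<^sub>v d" .
  then show ?thesis
    using transpose_vec_mult_scalar[OF P(1) zc u] P u zc by simp
qed

lemma vec_diff_split:
  fixes a b e z :: "real Matrix.vec"
  assumes "a \<in> carrier_vec d" "b \<in> carrier_vec d" "e \<in> carrier_vec d" "z \<in> carrier_vec d"
  shows "a - z = (a - b) - (z - b)" "e - a = ((e - z) - (a - b)) + (z - b)"
  using assms by (auto intro!: eq_vecI)

text \<open>The point \<open>z\<close> is arbitrary, not fixed by \<open>P\<close>: taking earlier iterates for \<open>z\<close> is what controls
  the last iterate rather than an average of iterates.\<close>

lemma orth_proj_descent:
  assumes proj: "orth_proj d P" and e: "e \<in> carrier_vec d" and z: "z \<in> carrier_vec d"
  shows "sqn (P *\<^sub>v e - z) \<le> sqn (e - z) - sqn (e - P *\<^sub>v e) / 2 + 2 * sqn (z - P *\<^sub>v z)"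
proof -
  have P: "P \<in> carrier_mat d d" using proj by (rule orth_proj_carrier)
  define u where "u = e - z"
  have u: "u \<in> carrier_vec d" using e z by (simp add: u_def)
  have Pu: "P *\<^sub>v u = P *\<^sub>v e - P *\<^sub>v z"
    unfolding u_def using P e z by (rule mult_minus_distrib_mat_vec)
  have c: "P *\<^sub>v e \<in> carrier_vec d" "P *\<^sub>v z \<in> carrier_vec d" "P *\<^sub>v u \<in> carrier_vec d"
    using P e z u by auto
  \<comment> \<open>The first part lies in the range of \<open>P\<close> and the second is
    orthogonal to that range, so there is no cross term.\<close>
  have "P *\<^sub>v e - z = P *\<^sub>v u - (z - P *\<^sub>v z)"
    unfolding Pu by (rule vec_diff_split(1)[OF c(1,2) e z])
  then have 1: "sqn (P *\<^sub>v e - z) = sqn (P *\<^sub>v u) + sqn (z - P *\<^sub>v z)"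
    using sqn_diff[of "P *\<^sub>v u" d "z - P *\<^sub>v z"] c z orth_proj_orthogonal[OF proj u z] by simp
  have 2: "sqn (u - P *\<^sub>v u) = sqn u - sqn (P *\<^sub>v u)" by (rule sqn_minus_proj[OF proj u])
  have "e - P *\<^sub>v e = (u - P *\<^sub>v u) + (z - P *\<^sub>v z)"
    unfolding Pu unfolding u_def by (rule vec_diff_split(2)[OF c(1,2) e z])
  \<comment> \<open>Solving for \<open>sqn (u - P *\<^sub>v u)\<close> costs one more
    \<open>sqn (z - P *\<^sub>v z)\<close>; hence the coefficients 1/2 and 2.\<close>
  then have "sqn (e - P *\<^sub>v e) \<le> 2 * sqn (u - P *\<^sub>v u) + 2 * sqn (z - P *\<^sub>v z)"
    using sqn_add_le[of "u - P *\<^sub>v u" d "z - P *\<^sub>v z"] c z u by simp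
  then show ?thesis using 1 2 by (simp add: u_def)
qed

section \<open>Random orderings\<close>

text \<open>Reordering by \<open>cyc a b\<close> postpones the task of step \<open>a + 1\<close> until step \<open>b + 1\<close>.\<close>

definition cyc :: "nat \<Rightarrow> nat \<Rightarrow> nat \<Rightarrow> nat" where
  "cyc a b i = (if i = Suc b then Suc a else if a < i \<and> i \<le> b then Suc i else i)"

lemma cyc_permutes:
  assumes "a \<le> b" "b < T"
  shows "cyc a b permutes {1..T}"
proof (rule bij_imp_permutes)
  have sub: "cyc a b ` {1..T} \<subseteq> {1..T}" using assms by (auto simp: cyc_def)
  have inj: "inj_on (cyc a b) {1..T}"
    using assms by (auto simp: cyc_def inj_on_def split: if_splits)
  show "bij_betw (cyc a b) {1..T} {1..T}"
    using endo_inj_surj[OF _ sub inj] inj by (simp add: bij_betw_def)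
  show "cyc a b x = x" if "x \<notin> {1..T}" for x
    using that assms by (auto simp: cyc_def)
qed

section \<open>Averages over uniformly random permutations\<close>

definition perms :: "nat \<Rightarrow> (nat \<Rightarrow> nat) set" where
  "perms T = {\<tau>. \<tau> permutes {1..T}}"

text \<open>A finite average instead of an integral, so that linearity and reindexing come without
  integrability conditions.\<close>

definition avg :: "nat \<Rightarrow> ((nat \<Rightarrow> nat) \<Rightarrow> real) \<Rightarrow> real" where
  "avg T g = (\<Sum>\<tau>\<in>perms T. g \<tau>) / real (card (perms T))"

lemma finite_perms: "finite (perms T)"
  by (simp add: perms_def finite_permutations)

lemma card_perms_pos: "card (perms T) > 0"
  using card_permutations[of "{1..T}" T] by (simp add: perms_def)

lemma expectation_random_ordering:
  "measure_pmf.expectation (random_ordering T) g = avg T g"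
  using finite_perms[of T] card_perms_pos[of T]
  by (subst random_ordering_def, subst integral_pmf_of_set)
    (auto simp: avg_def perms_def card_gt_0_iff)

lemma avg_mono: "(\<And>\<tau>. \<tau> \<in> perms T \<Longrightarrow> f \<tau> \<le> g \<tau>) \<Longrightarrow> avg T f \<le> avg T g"
  unfolding avg_def by (intro divide_right_mono sum_mono) auto

lemma avg_cong: "(\<And>\<tau>. \<tau> \<in> perms T \<Longrightarrow> f \<tau> = g \<tau>) \<Longrightarrow> avg T f = avg T g"
  unfolding avg_def by (intro arg_cong2[where f = "(/)"] sum.cong) auto

lemma avg_add: "avg T (\<lambda>\<tau>. f \<tau> + g \<tau>) = avg T f + avg T g"
  by (simp add: avg_def sum.distrib add_divide_distrib)

lemma avg_diff: "avg T (\<lambda>\<tau>. f \<tau> - g \<tau>) = avg T f - avg T g"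
  by (simp add: avg_def sum_subtractf diff_divide_distrib)

lemma avg_cmult: "avg T (\<lambda>\<tau>. c * f \<tau>) = c * avg T f"
  by (simp add: avg_def sum_distrib_left)

lemma avg_const: "avg T (\<lambda>\<tau>. c) = c"
  using card_perms_pos[of T] by (simp add: avg_def)

lemma avg_sum: "avg T (\<lambda>\<tau>. \<Sum>i\<in>I. f i \<tau>) = (\<Sum>i\<in>I. avg T (f i))"
  unfolding avg_def by (subst sum.swap) (simp add: sum_divide_distrib)

lemma avg_nonneg: "(\<And>\<tau>. \<tau> \<in> perms T \<Longrightarrow> 0 \<le> f \<tau>) \<Longrightarrow> 0 \<le> avg T f"
  using avg_mono[of T "\<lambda>_. 0" f] by (simp add: avg_const)

text \<open>Exchangeability: composing on the right with a fixed permutation of positions is a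
  bijection of \<open>perms T\<close>.\<close>

lemma avg_comp: "\<sigma> permutes {1..T} \<Longrightarrow> avg T (\<lambda>\<tau>. g (\<tau> \<circ> \<sigma>)) = avg T g"
  unfolding avg_def perms_def using sum_permutations_compose_right[of \<sigma> "{1..T}" g] by simp

lemma sum_permuted:
  assumes "\<tau> \<in> perms T"
  shows "(\<Sum>i=1..T. f (\<tau> i)) = (\<Sum>m=1..T. f m :: real)"
  using assms sum.permute[of \<tau> "{1..T}" f] by (simp add: perms_def o_def)

text \<open>Swapping positions shows that every position has the same average, and the sum over all
  positions does not depend on \<open>\<tau>\<close>.\<close>

lemma avg_first:
  assumes "0 < T"
  shows "avg T (\<lambda>\<tau>. f (\<tau> 1)) = (\<Sum>m=1..T. f m) / real T"
proof -
  have "avg T (\<lambda>\<tau>. f (\<tau> i)) = avg T (\<lambda>\<tau>. f (\<tau> 1))" if "i \<in> {1..T}" for i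
    using avg_comp[OF permutes_swap_id[of 1 "{1..T}" i], of "\<lambda>\<tau>. f (\<tau> 1)"] that assms by simp
  then have "(\<Sum>i=1..T. avg T (\<lambda>\<tau>. f (\<tau> i))) = (\<Sum>i=1..T. avg T (\<lambda>\<tau>. f (\<tau> 1)))"
    by (rule sum.cong[OF refl])
  then have "real T * avg T (\<lambda>\<tau>. f (\<tau> 1)) = (\<Sum>i=1..T. avg T (\<lambda>\<tau>. f (\<tau> i)))"
    by (simp only: sum_constant card_atLeastAtMost diff_Suc_1)
  also have "\<dots> = avg T (\<lambda>\<tau>. \<Sum>m=1..T. f m)"
    unfolding avg_sum[symmetric] by (rule avg_cong) (rule sum_permuted)
  finally show ?thesis using assms by (simp add: avg_const field_simps)
qed

text \<open>Every natural number indexes a projection, so that statements about a sequence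
  \<open>\<tau>\<close> carry no range conditions.\<close>

locale proj_seq =
  fixes d :: nat and P :: "nat \<Rightarrow> real mat"
  assumes proj: "orth_proj d (P m)"
begin

lemma P_carrier [simp]: "P m \<in> carrier_mat d d"
  using proj by (rule orth_proj_carrier)

section \<open>Products of projections along an ordering, errors and residuals\<close>

primrec prod_mat :: "(nat \<Rightarrow> nat) \<Rightarrow> nat \<Rightarrow> real mat" where
  "prod_mat \<tau> 0 = 1\<^sub>m d"
| "prod_mat \<tau> (Suc t) = P (\<tau> (Suc t)) * prod_mat \<tau> t"

definition err :: "real Matrix.vec \<Rightarrow> (nat \<Rightarrow> nat) \<Rightarrow> nat \<Rightarrow> real Matrix.vec" where
  "err v \<tau> t = prod_mat \<tau> t *\<^sub>v v"

definition res :: "nat \<Rightarrow> real Matrix.vec \<Rightarrow> real Matrix.vec" where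
  "res m x = x - P m *\<^sub>v x"

lemma prod_mat_carrier [simp]: "prod_mat \<tau> t \<in> carrier_mat d d"
  by (induction t) (auto intro: mult_carrier_mat[of _ d d])

lemma prod_mat_cong: "(\<And>i. i \<in> {1..t} \<Longrightarrow> \<tau> i = \<tau>' i) \<Longrightarrow> prod_mat \<tau> t = prod_mat \<tau>' t"
  by (induction t) auto

lemma err_cong: "(\<And>i. i \<in> {1..t} \<Longrightarrow> \<tau> i = \<tau>' i) \<Longrightarrow> err v \<tau> t = err v \<tau>' t"
  using prod_mat_cong by (metis err_def)

lemma err_0: "v \<in> carrier_vec d \<Longrightarrow> err v \<tau> 0 = v"
  by (simp add: err_def)

lemma err_carrier [simp]: "v \<in> carrier_vec d \<Longrightarrow> err v \<tau> t \<in> carrier_vec d"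
  unfolding err_def by (rule mult_mat_vec_carrier[OF prod_mat_carrier])

lemma err_Suc: "v \<in> carrier_vec d \<Longrightarrow> err v \<tau> (Suc t) = P (\<tau> (Suc t)) *\<^sub>v err v \<tau> t"
  unfolding err_def prod_mat.simps by (rule assoc_mult_mat_vec[OF P_carrier prod_mat_carrier])

lemma res_carrier [simp]: "x \<in> carrier_vec d \<Longrightarrow> res m x \<in> carrier_vec d"
  by (simp add: res_def minus_carrier_vec mult_mat_vec_carrier[OF P_carrier])

lemma P_mult_carrier [simp]: "x \<in> carrier_vec d \<Longrightarrow> P m *\<^sub>v x \<in> carrier_vec d"
  by (rule mult_mat_vec_carrier[OF P_carrier])

lemma sqn_res: "x \<in> carrier_vec d \<Longrightarrow> sqn (res m x) = sqn x - sqn (P m *\<^sub>v x)"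
  unfolding res_def by (rule sqn_minus_proj[OF proj])

lemma sqn_res_le: "x \<in> carrier_vec d \<Longrightarrow> sqn (res m x) \<le> sqn x"
  by (simp add: sqn_res)

lemma sqn_P_le: "x \<in> carrier_vec d \<Longrightarrow> sqn (P m *\<^sub>v x) \<le> sqn x"
  using sqn_res[of x m] sqn_nonneg[of "res m x"] by simp

text \<open>By Pythagoras each step lowers the squared error by exactly the squared residual, so the
  sum telescopes.\<close>

lemma sum_sqn_res:
  assumes v: "v \<in> carrier_vec d"
  shows "(\<Sum>t<k. sqn (res (\<tau> (Suc t)) (err v \<tau> t))) = sqn v - sqn (err v \<tau> k)"
  by (induction k) (simp_all add: v err_0 err_Suc sqn_res)

text \<open>\<open>orth_proj_descent\<close> is applied at every step with the same reference point,
  the error after \<open>j\<close> steps.\<close>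

lemma sqn_err_diff_le:
  assumes v: "v \<in> carrier_vec d" and "j \<le> k"
  shows "sqn (err v \<tau> k - err v \<tau> j) \<le>
    (\<Sum>t=j..<k. 2 * sqn (res (\<tau> (Suc t)) (err v \<tau> j)) - sqn (res (\<tau> (Suc t)) (err v \<tau> t)) / 2)"
  using \<open>j \<le> k\<close>
proof (induction rule: dec_induct)
  case base
  then show ?case by (simp add: sqn_sum)
next
  case (step k)
  have "sqn (err v \<tau> (Suc k) - err v \<tau> j) \<le> sqn (err v \<tau> k - err v \<tau> j)
      - sqn (res (\<tau> (Suc k)) (err v \<tau> k)) / 2 + 2 * sqn (res (\<tau> (Suc k)) (err v \<tau> j))"
    unfolding err_Suc[OF v] res_def
    by (rule orth_proj_descent[OF proj err_carrier[OF v] err_carrier[OF v]])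
  then show ?case using step by (simp add: sum.atLeastLessThan_Suc)
qed

section \<open>Expected residual for a task not yet seen, the sequence \<open>g\<close> of the
  outline\<close>

definition fresh_res :: "nat \<Rightarrow> real Matrix.vec \<Rightarrow> nat \<Rightarrow> real" where
  "fresh_res T v j = avg T (\<lambda>\<tau>. sqn (res (\<tau> (Suc j)) (err v \<tau> j)))"

lemma fresh_res_nonneg: "0 \<le> fresh_res T v j"
  unfolding fresh_res_def by (rule avg_nonneg) simp

text \<open>Swapping the positions \<open>j + 1\<close> and \<open>t + 1\<close> leaves the first
  \<open>j\<close> entries, hence the error, unchanged.\<close>

lemma avg_fresh:
  assumes "j \<le> t" "t < T"
  shows "avg T (\<lambda>\<tau>. sqn (res (\<tau> (Suc t)) (err v \<tau> j))) = fresh_res T v j"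
proof -
  define \<sigma> where "\<sigma> = Transposition.transpose (Suc j) (Suc t)"
  have "\<sigma> permutes {1..T}"
    unfolding \<sigma>_def using assms by (intro permutes_swap_id) auto
  then have "fresh_res T v j = avg T (\<lambda>\<tau>. sqn (res ((\<tau> \<circ> \<sigma>) (Suc j)) (err v (\<tau> \<circ> \<sigma>) j)))"
    unfolding fresh_res_def by (rule avg_comp[symmetric])
  moreover have "err v (\<tau> \<circ> \<sigma>) j = err v \<tau> j" for \<tau>
    using assms by (intro err_cong) (auto simp: \<sigma>_def transpose_def)
  ultimately show ?thesis by (simp add: \<sigma>_def)
qed

text \<open>\<open>sqn_err_diff_le\<close> is averaged up to step \<open>k + 1\<close>. All tasks
  involved are still fresh at time \<open>j\<close>, so each residual of the error after
  \<open>j\<close> steps averages to \<open>fresh_res T v j\<close>. The squared distance on the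
  left is nonnegative, and the coefficients 2 and 1/2 combine to 4.\<close>

lemma sum_fresh_res_suffix_le:
  assumes v: "v \<in> carrier_vec d" and "j \<le> k" "k < T"
  shows "(\<Sum>t=j..k. fresh_res T v t) \<le> 4 * (real k - real j + 1) * fresh_res T v j"
proof -
  have "0 \<le> avg T (\<lambda>\<tau>. \<Sum>t=j..<Suc k. 2 * sqn (res (\<tau> (Suc t)) (err v \<tau> j))
      - sqn (res (\<tau> (Suc t)) (err v \<tau> t)) / 2)"
    using sqn_err_diff_le[OF v, of j "Suc k"] \<open>j \<le> k\<close>
    by (intro avg_nonneg) (meson le_SucI order_trans sqn_nonneg)
  also have "\<dots> = (\<Sum>t=j..<Suc k. 2 * avg T (\<lambda>\<tau>. sqn (res (\<tau> (Suc t)) (err v \<tau> j)))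
      - (1 / 2) * avg T (\<lambda>\<tau>. sqn (res (\<tau> (Suc t)) (err v \<tau> t))))"
    unfolding avg_sum avg_diff avg_cmult[symmetric] by simp
  also have "\<dots> = (\<Sum>t=j..<Suc k. 2 * fresh_res T v j - (1 / 2) * fresh_res T v t)"
    using \<open>k < T\<close> by (intro sum.cong) (auto simp: avg_fresh)
  also have "\<dots> = 2 * (real k - real j + 1) * fresh_res T v j - (1 / 2) * (\<Sum>t=j..k. fresh_res T v t)"
    using \<open>j \<le> k\<close> by (simp add: sum_subtractf atLeastLessThanSuc_atLeastAtMost sum_divide_distrib
        of_nat_diff Suc_diff_le add.commute)
  finally show ?thesis by (simp add: algebra_simps)
qed

lemma sum_fresh_res_le:
  assumes v: "v \<in> carrier_vec d"
  shows "(\<Sum>t<k. fresh_res T v t) \<le> sqn v"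
proof -
  have "(\<Sum>t<k. fresh_res T v t) = avg T (\<lambda>\<tau>. sqn v - sqn (err v \<tau> k))"
    unfolding fresh_res_def avg_sum[symmetric] sum_sqn_res[OF v] ..
  also have "\<dots> \<le> avg T (\<lambda>\<tau>. sqn v)" by (rule avg_mono) simp
  finally show ?thesis by (simp add: avg_const)
qed

lemma fresh_res_le_root:
  assumes v: "v \<in> carrier_vec d" and "k < T"
  shows "fresh_res T v k \<le> root 4 (2 / (real k + 2)) * sqn v"
proof -
  have "fresh_res T v k \<le> root 4 (2 / (real k + 2)) * (\<Sum>t\<le>k. fresh_res T v t)"
    by (rule last_term_le_root_sum) (use sum_fresh_res_suffix_le[OF v] \<open>k < T\<close> fresh_res_nonneg in auto)
  also have "\<dots> \<le> root 4 (2 / (real k + 2)) * sqn v"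
    using sum_fresh_res_le[OF v, of T "Suc k"]
    by (intro mult_left_mono) (auto simp: lessThan_Suc_atMost real_root_ge_zero)
  finally show ?thesis .
qed

section \<open>Residuals for tasks already seen\<close>

lemma sqn_err_skip_le:
  assumes v: "v \<in> carrier_vec d" and "a \<le> b"
  shows "sqn (err v \<tau> (Suc b) - err v (\<lambda>i. \<tau> (if i \<le> a then i else Suc i)) b)
    \<le> sqn (res (\<tau> (Suc a)) (err v \<tau> a))"
  using \<open>a \<le> b\<close>
proof (induction rule: dec_induct)
  case base
  \<comment> \<open>Both runs agree up to step \<open>a\<close>; omitting step \<open>a + 1\<close>
    changes the error by exactly the residual removed there.\<close>
  have "err v (\<lambda>i. \<tau> (if i \<le> a then i else Suc i)) a = err v \<tau> a"
    by (rule err_cong) auto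
  then show ?case
    using sqn_diff_commute[of "P (\<tau> (Suc a)) *\<^sub>v err v \<tau> a" d "err v \<tau> a"] v
    by (simp add: err_Suc res_def)
next
  case (step b)
  define \<tau>' where "\<tau>' = (\<lambda>i. \<tau> (if i \<le> a then i else Suc i))"
  \<comment> \<open>From then on both runs apply the same projections, the shortened one a step
    earlier, and projections are nonexpansive.\<close>
  have "\<tau>' (Suc b) = \<tau> (Suc (Suc b))" using step by (simp add: \<tau>'_def)
  then have "err v \<tau> (Suc (Suc b)) - err v \<tau>' (Suc b) =
      P (\<tau> (Suc (Suc b))) *\<^sub>v (err v \<tau> (Suc b) - err v \<tau>' b)"
    by (simp add: err_Suc[OF v, of \<tau> "Suc b"] err_Suc[OF v, of \<tau>' b]
        mult_minus_distrib_mat_vec[OF P_carrier err_carrier[OF v] err_carrier[OF v]])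
  then have "sqn (err v \<tau> (Suc (Suc b)) - err v \<tau>' (Suc b)) \<le> sqn (err v \<tau> (Suc b) - err v \<tau>' b)"
    using sqn_P_le v by (metis err_carrier minus_carrier_vec)
  then show ?case using step by (simp add: \<tau>'_def)
qed

text \<open>The reordering by \<open>cyc a b\<close> puts the task of step \<open>a + 1\<close> at
  position \<open>b + 1\<close>, where it is fresh. The residual splits linearly into that of the
  shortened run and that of the difference of the runs; the factors 2 come from squaring a sum of
  two vectors.\<close>

lemma avg_seen_le:
  assumes v: "v \<in> carrier_vec d" and "a \<le> b" "b < T"
  shows "avg T (\<lambda>\<tau>. sqn (res (\<tau> (Suc a)) (err v \<tau> (Suc b)))) \<le> 2 * fresh_res T v b + 2 * fresh_res T v a"
proof -
  have "sqn (res (\<tau> (Suc a)) (err v \<tau> (Suc b))) \<le>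
      2 * sqn (res ((\<tau> \<circ> cyc a b) (Suc b)) (err v (\<tau> \<circ> cyc a b) b))
      + 2 * sqn (res (\<tau> (Suc a)) (err v \<tau> a))" for \<tau>
  proof -
    define x where "x = err v (\<tau> \<circ> cyc a b) b"
    define y where "y = err v \<tau> (Suc b)"
    have c: "x \<in> carrier_vec d" "y \<in> carrier_vec d" using v by (auto simp: x_def y_def)
    \<comment> \<open>The first \<open>b\<close> entries of \<open>\<tau> \<circ> cyc a b\<close>
      are those of \<open>\<tau>\<close> with entry \<open>a + 1\<close> skipped.\<close>
    have x: "x = err v (\<lambda>i. \<tau> (if i \<le> a then i else Suc i)) b"
      unfolding x_def using \<open>a \<le> b\<close> by (intro err_cong) (auto simp: cyc_def)
    have "P m *\<^sub>v (y - x) = P m *\<^sub>v y - P m *\<^sub>v x" for m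
      using c by (intro mult_minus_distrib_mat_vec[OF P_carrier])
    then have "res m y = res m (y - x) + res m x" for m
      unfolding res_def
      using vec_diff_split(2)[OF P_mult_carrier[OF c(2)] P_mult_carrier[OF c(1)] c(2,1)] by simp
    then have "sqn (res m y) \<le> 2 * sqn (res m x) + 2 * sqn (res m (y - x))" for m
      using sqn_add_le[of "res m (y - x)" d "res m x"] c by simp
    moreover have "sqn (res m (y - x)) \<le> sqn (y - x)" for m
      using c by (intro sqn_res_le) auto
    moreover have "sqn (y - x) \<le> sqn (res (\<tau> (Suc a)) (err v \<tau> a))"
      unfolding x y_def by (rule sqn_err_skip_le[OF v \<open>a \<le> b\<close>])
    ultimately have "sqn (res m y) \<le> 2 * sqn (res m x) + 2 * sqn (res (\<tau> (Suc a)) (err v \<tau> a))" for m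
      by (smt (verit))
    then show ?thesis by (simp add: x_def y_def cyc_def)
  qed
  then have "avg T (\<lambda>\<tau>. sqn (res (\<tau> (Suc a)) (err v \<tau> (Suc b)))) \<le>
     avg T (\<lambda>\<tau>. 2 * sqn (res ((\<tau> \<circ> cyc a b) (Suc b)) (err v (\<tau> \<circ> cyc a b) b))
      + 2 * sqn (res (\<tau> (Suc a)) (err v \<tau> a)))"
    by (rule avg_mono)
  also have "\<dots> = 2 * fresh_res T v b + 2 * fresh_res T v a"
    unfolding avg_add avg_cmult fresh_res_def
    using avg_comp[OF cyc_permutes[OF assms(2,3)], of "\<lambda>\<tau>. sqn (res (\<tau> (Suc b)) (err v \<tau> b))"]
    by simp
  finally show ?thesis .
qed

lemma sum_avg_seen_le:
  assumes v: "v \<in> carrier_vec d" and "b < T"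
  shows "(\<Sum>a\<le>b. avg T (\<lambda>\<tau>. sqn (res (\<tau> (Suc a)) (err v \<tau> (Suc b)))))
    \<le> 2 * (real b + 1) * fresh_res T v b + 2 * sqn v"
proof -
  have "(\<Sum>a\<le>b. avg T (\<lambda>\<tau>. sqn (res (\<tau> (Suc a)) (err v \<tau> (Suc b)))))
      \<le> (\<Sum>a\<le>b. 2 * fresh_res T v b + 2 * fresh_res T v a)"
    using avg_seen_le[OF v] \<open>b < T\<close> by (intro sum_mono) auto
  also have "\<dots> = 2 * (real b + 1) * fresh_res T v b + 2 * (\<Sum>a<Suc b. fresh_res T v a)"
    by (simp add: sum.distrib lessThan_Suc_atMost sum_distrib_left algebra_simps)
  finally show ?thesis using sum_fresh_res_le[OF v, of T "Suc b"] by simp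
qed

section \<open>The Frobenius analogue for the dimension-dependent rate\<close>

definition fresh_frob :: "nat \<Rightarrow> nat \<Rightarrow> real" where
  "fresh_frob T j = avg T (\<lambda>\<tau>. frob (prod_mat \<tau> j - P (\<tau> (Suc j)) * prod_mat \<tau> j))"

lemma prod_mat_Suc_shift: "prod_mat \<tau> (Suc b) = prod_mat (\<lambda>i. \<tau> (Suc i)) b * P (\<tau> 1)"
proof (induction b)
  case 0
  then show ?case by (simp add: right_mult_one_mat[OF P_carrier] left_mult_one_mat[OF P_carrier])
next
  case (Suc b)
  have "prod_mat \<tau> (Suc (Suc b)) = P (\<tau> (Suc (Suc b))) * (prod_mat (\<lambda>i. \<tau> (Suc i)) b * P (\<tau> 1))"
    using Suc by simp
  also have "\<dots> = P (\<tau> (Suc (Suc b))) * prod_mat (\<lambda>i. \<tau> (Suc i)) b * P (\<tau> 1)"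
    by (intro assoc_mult_mat[symmetric, of _ d d _ d _ d]) auto
  finally show ?case by simp
qed

text \<open>By exchangeability the first factor of the product may be dropped; for the Frobenius norm this
  is monotone, whereas the residual of a fixed vector need not be.\<close>

lemma fresh_frob_Suc_le:
  assumes "Suc b < T"
  shows "fresh_frob T (Suc b) \<le> fresh_frob T b"
proof -
  \<comment> \<open>This moves the first task to position \<open>b + 2\<close> and the tasks at
    positions \<open>2\<close> to \<open>b + 2\<close> one place forward, so
    \<open>\<tau> (b + 2)\<close> becomes the task right after the first \<open>b\<close>
    entries.\<close>
  let ?\<sigma> = "cyc 0 (Suc b)"
  have "frob (prod_mat \<tau> (Suc b) - P (\<tau> (Suc (Suc b))) * prod_mat \<tau> (Suc b)) \<le>
      frob (prod_mat (\<tau> \<circ> ?\<sigma>) b - P ((\<tau> \<circ> ?\<sigma>) (Suc b)) * prod_mat (\<tau> \<circ> ?\<sigma>) b)" for \<tau>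
  proof -
    define A where "A = prod_mat (\<tau> \<circ> ?\<sigma>) b"
    define B where "B = P (\<tau> (Suc (Suc b)))"
    have c: "A \<in> carrier_mat d d" "B \<in> carrier_mat d d" by (auto simp: A_def B_def)
    have "A = prod_mat (\<lambda>i. \<tau> (Suc i)) b"
      unfolding A_def by (intro prod_mat_cong) (auto simp: cyc_def)
    then have shift: "prod_mat \<tau> (Suc b) = A * P (\<tau> 1)" by (simp only: prod_mat_Suc_shift)
    have "A * P (\<tau> 1) - B * (A * P (\<tau> 1)) = A * P (\<tau> 1) - B * A * P (\<tau> 1)"
      by (simp only: assoc_mult_mat[OF c(2,1) P_carrier])
    also have "\<dots> = (A - B * A) * P (\<tau> 1)"
      by (rule minus_mult_distrib_mat[symmetric, OF c(1) mult_carrier_mat[OF c(2,1)] P_carrier])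
    finally have "frob (A * P (\<tau> 1) - B * (A * P (\<tau> 1))) \<le> frob (A - B * A)"
      using frob_mult_proj_le[OF proj, of "A - B * A" d "\<tau> 1"] c
      by (metis minus_carrier_mat mult_carrier_mat)
    then show ?thesis
      unfolding shift by (simp add: A_def B_def cyc_def)
  qed
  then have "fresh_frob T (Suc b) \<le> avg T (\<lambda>\<tau>. frob (prod_mat (\<tau> \<circ> ?\<sigma>) b - P ((\<tau> \<circ> ?\<sigma>) (Suc b)) * prod_mat (\<tau> \<circ> ?\<sigma>) b))"
    unfolding fresh_frob_def by (intro avg_mono)
  also have "\<dots> = fresh_frob T b"
    unfolding fresh_frob_def by (rule avg_comp) (use assms in \<open>intro cyc_permutes; simp\<close>)
  finally show ?thesis .
qed

lemma fresh_frob_antimono: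
  assumes "j \<le> k" "k < T"
  shows "fresh_frob T k \<le> fresh_frob T j"
  using assms
proof (induction rule: dec_induct)
  case (step k)
  then show ?case using fresh_frob_Suc_le[of k T] by simp
qed simp

text \<open>Each decrease of the squared Frobenius norm is a squared residual, so these telescope;
  the last of \<open>k\<close> nonincreasing terms is at most their mean.\<close>

lemma fresh_frob_le:
  assumes "k < T"
  shows "real k * fresh_frob T k \<le> (\<Sum>m=1..T. frob (P m)) / real T"
proof -
  define h where "h \<tau> j = frob (prod_mat \<tau> j - P (\<tau> (Suc j)) * prod_mat \<tau> j)" for \<tau> j
  have step: "h \<tau> j = frob (prod_mat \<tau> j) - frob (prod_mat \<tau> (Suc j))" for \<tau> j
    unfolding h_def prod_mat.simps by (rule frob_minus_proj[OF proj prod_mat_carrier])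
  \<comment> \<open>Summation starts at 1: the product is then the projection
    \<open>P (\<tau> 1)\<close>, whose \<open>frob\<close> brings in the rank, whereas index 0 would
    give the full dimension \<open>d\<close>.\<close>
  have tele: "(\<Sum>j=1..<Suc k. h \<tau> j) = frob (prod_mat \<tau> 1) - frob (prod_mat \<tau> (Suc k))" for \<tau>
    by (induction k) (simp_all add: step del: prod_mat.simps)
  have M1: "prod_mat \<tau> 1 = P (\<tau> 1)" for \<tau> by (simp add: right_mult_one_mat[OF P_carrier])
  have "real k * fresh_frob T k = (\<Sum>j=1..<Suc k. fresh_frob T k)" by simp
  also have "\<dots> \<le> (\<Sum>j=1..<Suc k. fresh_frob T j)"
    using fresh_frob_antimono assms by (intro sum_mono) auto
  also have "\<dots> = avg T (\<lambda>\<tau>. frob (P (\<tau> 1)) - frob (prod_mat \<tau> (Suc k)))"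
    unfolding fresh_frob_def avg_sum[symmetric] h_def[symmetric] tele M1 ..
  also have "\<dots> \<le> avg T (\<lambda>\<tau>. frob (P (\<tau> 1)))" by (rule avg_mono) simp
  also have "\<dots> = (\<Sum>m=1..T. frob (P m)) / real T"
    using assms avg_first[of T "\<lambda>m. frob (P m)"] by simp
  finally show ?thesis .
qed

text \<open>The residual is linear in the starting vector, so \<open>sqn_mult_mat_vec_le\<close>
  applies to its matrix.\<close>

lemma fresh_res_le_fresh_frob:
  assumes v: "v \<in> carrier_vec d"
  shows "fresh_res T v k \<le> fresh_frob T k * sqn v"
proof -
  have "sqn (res m (err v \<tau> k)) \<le> sqn v * frob (prod_mat \<tau> k - P m * prod_mat \<tau> k)" for m \<tau>
  proof -
    have c: "P m * prod_mat \<tau> k \<in> carrier_mat d d" by (rule mult_carrier_mat[OF P_carrier prod_mat_carrier])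
    have "res m (err v \<tau> k) = prod_mat \<tau> k *\<^sub>v v - (P m * prod_mat \<tau> k) *\<^sub>v v"
      unfolding res_def err_def using assoc_mult_mat_vec[OF P_carrier prod_mat_carrier v] by simp
    also have "\<dots> = (prod_mat \<tau> k - P m * prod_mat \<tau> k) *\<^sub>v v"
      by (rule minus_mult_distrib_mat_vec[symmetric, OF prod_mat_carrier c v])
    finally show ?thesis
      using sqn_mult_mat_vec_le[OF minus_carrier_mat[OF c] v] by (simp add: mult.commute)
  qed
  then have "fresh_res T v k \<le> avg T (\<lambda>\<tau>. sqn v * frob (prod_mat \<tau> k - P (\<tau> (Suc k)) * prod_mat \<tau> k))"
    unfolding fresh_res_def by (intro avg_mono)
  then show ?thesis by (simp add: avg_cmult fresh_frob_def mult.commute)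
qed

lemma fresh_res_le_trace:
  assumes v: "v \<in> carrier_vec d" and "0 < k" "k < T"
  shows "fresh_res T v k \<le> (\<Sum>m=1..T. frob (P m)) / real T / real k * sqn v"
proof -
  have "fresh_frob T k \<le> (\<Sum>m=1..T. frob (P m)) / real T / real k"
    using fresh_frob_le[OF \<open>k < T\<close>] \<open>0 < k\<close> by (subst pos_le_divide_eq) (simp_all add: mult.commute)
  then have "fresh_frob T k * sqn v \<le> (\<Sum>m=1..T. frob (P m)) / real T / real k * sqn v"
    by (rule mult_right_mono) simp
  then show ?thesis using fresh_res_le_fresh_frob[OF v, of T k] by (rule order_trans[rotated])
qed

section \<open>Explicit rates and summation over positions\<close>

lemma real_root_4_le_self: "1 \<le> x \<Longrightarrow> root 4 x \<le> x"
  using real_root_le_mono[of 4 x "x ^ 4"] self_le_power[of x 4] by (simp add: real_root_power_cancel)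

lemma root_4_decay:
  fixes b :: real
  assumes "1 \<le> b" "b \<le> k"
  shows "root 4 (2 / (k + 2)) \<le> 2 / root 4 b"
proof -
  have "root 4 (2 / (k + 2)) \<le> root 4 (2 / b)"
    using assms by (intro real_root_le_mono) (auto intro!: divide_left_mono)
  also have "\<dots> = root 4 2 / root 4 b" by (simp add: real_root_divide)
  also have "\<dots> \<le> 2 / root 4 b"
    using assms real_root_4_le_self[of 2] by (intro divide_right_mono) (auto simp: real_root_ge_zero)
  finally show ?thesis .
qed

text \<open>The first bound serves the \<open>k\<close> tasks already seen, where
  \<open>sqn v / real k\<close> is the share per task of the total cost of deleting steps; the
  second serves the unseen tasks, which exist only for \<open>k < T\<close>.\<close>

lemma rate_bounds:
  assumes v: "v \<in> carrier_vec d" and k: "2 \<le> k" "k \<le> T"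
  defines "tr \<equiv> (\<Sum>m=1..T. frob (P m)) / real T"
  defines "C \<equiv> min (7 / root 4 (real k - 1)) ((tr + 1) / (real k - 1)) * sqn v"
  shows "fresh_res T v (k - 1) + sqn v / real k \<le> C" and "k < T \<Longrightarrow> fresh_res T v k \<le> C"
proof -
  define b where "b = real k - 1"
  have b: "1 \<le> b" "b \<le> real k" "real (k - 1) = b" using k by (auto simp: b_def)
  have tr: "0 \<le> tr" by (simp add: tr_def sum_nonneg)
  have C: "C = min (7 / root 4 b * sqn v) ((tr + 1) / b * sqn v)"
    unfolding C_def b_def[symmetric] using sqn_nonneg[of v] by (simp add: min_mult_distrib_right)
  have root_pos: "0 < root 4 b" using b by simp
  have inv_k: "1 / real k \<le> 1 / b" "1 / real k \<le> 1 / root 4 b"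
    using b root_pos real_root_4_le_self[OF b(1)] by (auto intro!: divide_left_mono)
  have "fresh_res T v (k - 1) \<le> 2 / root 4 b * sqn v"
    using fresh_res_le_root[OF v, of "k - 1" T] k root_4_decay[of b b] b
      mult_right_mono[of _ "2 / root 4 b" "sqn v"] by (fastforce intro: order_trans)
  moreover have "sqn v / real k \<le> 1 / root 4 b * sqn v"
    using mult_right_mono[OF inv_k(2), of "sqn v"] by simp
  \<comment> \<open>The argument gives the constant 3: 2 from the fresh residual and 1 from
    \<open>sqn v / real k\<close>.\<close>
  moreover have "3 / root 4 b * sqn v \<le> 7 / root 4 b * sqn v"
    using root_pos by (intro mult_right_mono divide_right_mono) auto
  moreover have "2 / root 4 b * sqn v + 1 / root 4 b * sqn v = 3 / root 4 b * sqn v"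
    by (simp add: field_simps)
  moreover have "fresh_res T v (k - 1) \<le> tr / b * sqn v"
    using fresh_res_le_trace[OF v, of "k - 1" T] k b by (simp add: tr_def)
  moreover have "sqn v / real k \<le> 1 / b * sqn v"
    using mult_right_mono[OF inv_k(1), of "sqn v"] by simp
  moreover have "tr / b * sqn v + 1 / b * sqn v = (tr + 1) / b * sqn v"
    by (simp add: add_divide_distrib distrib_right)
  ultimately show "fresh_res T v (k - 1) + sqn v / real k \<le> C"
    unfolding C by (intro min.boundedI) linarith+
  assume "k < T"
  have "fresh_res T v k \<le> root 4 (2 / (real k + 2)) * sqn v" by (rule fresh_res_le_root[OF v \<open>k < T\<close>])
  also have "\<dots> \<le> 2 / root 4 b * sqn v"
    using root_4_decay[OF b(1,2)] by (rule mult_right_mono) simp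
  also have "\<dots> \<le> 7 / root 4 b * sqn v"
    using root_pos by (intro mult_right_mono divide_right_mono) auto
  finally have 1: "fresh_res T v k \<le> 7 / root 4 b * sqn v" .
  have "fresh_res T v k \<le> tr / real k * sqn v"
    using fresh_res_le_trace[OF v _ \<open>k < T\<close>] k by (simp add: tr_def)
  also have "\<dots> \<le> (tr + 1) / b * sqn v"
    using b tr by (intro mult_right_mono frac_le) auto
  finally show "fresh_res T v k \<le> C" unfolding C using 1 by simp
qed

text \<open>Positions up to \<open>k\<close> are covered by the bound for seen tasks, the later ones
  by exchangeability. The factor 2 cancels the 1/2 in the losses.\<close>

lemma sum_avg_res_le:
  assumes v: "v \<in> carrier_vec d" and k: "2 \<le> k" "k \<le> T"
    and C1: "fresh_res T v (k - 1) + sqn v / real k \<le> C" and C2: "k < T \<Longrightarrow> fresh_res T v k \<le> C"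
  shows "(\<Sum>t=1..k. avg T (\<lambda>\<tau>. sqn (res (\<tau> t) (err v \<tau> k)))) \<le> 2 * real k * C"
    and "(\<Sum>t=1..T. avg T (\<lambda>\<tau>. sqn (res (\<tau> t) (err v \<tau> k)))) \<le> 2 * real T * C"
proof -
  define f where "f t = avg T (\<lambda>\<tau>. sqn (res (\<tau> t) (err v \<tau> k)))" for t
  obtain b where b: "k = Suc b" using k by (cases k) auto
  have "(\<Sum>t=1..k. f t) = (\<Sum>a\<le>b. f (Suc a))"
    unfolding b by (simp only: One_nat_def sum.atLeast_Suc_atMost_Suc_shift o_def atLeast0AtMost)
  also have "\<dots> \<le> 2 * (real b + 1) * fresh_res T v b + 2 * sqn v"
    unfolding f_def b by (rule sum_avg_seen_le[OF v]) (use b k in simp)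
  also have "\<dots> = 2 * real k * (fresh_res T v (k - 1) + sqn v / real k)"
    by (simp add: b field_simps)
  also have "\<dots> \<le> 2 * real k * C" using C1 by (intro mult_left_mono) auto
  finally have seen: "(\<Sum>t=1..k. f t) \<le> 2 * real k * C" .
  then show "(\<Sum>t=1..k. avg T (\<lambda>\<tau>. sqn (res (\<tau> t) (err v \<tau> k)))) \<le> 2 * real k * C"
    by (simp add: f_def)
  have "0 \<le> C" using C1 fresh_res_nonneg[of T v "k - 1"] sqn_nonneg[of v]
    by (smt (verit) divide_nonneg_nonneg of_nat_0_le_iff)
  \<comment> \<open>A factor 2 is given away here so that seen and unseen positions share one
    bound.\<close>
  have "f t \<le> 2 * C" if "t \<in> {Suc k..T}" for t
  proof -
    have "f (Suc (t - 1)) = fresh_res T v k" unfolding f_def using that by (intro avg_fresh) auto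
    then have "f t = fresh_res T v k" using that by simp
    then show ?thesis using C2 that \<open>0 \<le> C\<close> by auto
  qed
  then have "(\<Sum>t=Suc k..T. f t) \<le> (\<Sum>t=Suc k..T. 2 * C)" by (rule sum_mono)
  also have "\<dots> = 2 * (real T - real k) * C" using k by (simp add: of_nat_diff)
  finally have "(\<Sum>t=Suc k..T. f t) \<le> 2 * (real T - real k) * C" .
  moreover have "(\<Sum>t=1..T. f t) = (\<Sum>t=1..k. f t) + (\<Sum>t=Suc k..T. f t)"
    using k sum.ub_add_nat[of 1 k f "T - k"] by simp
  ultimately have "(\<Sum>t=1..T. f t) \<le> 2 * real T * C"
    using seen by (simp add: algebra_simps)
  then show "(\<Sum>t=1..T. avg T (\<lambda>\<tau>. sqn (res (\<tau> t) (err v \<tau> k)))) \<le> 2 * real T * C"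
    by (simp add: f_def)
qed

end

section \<open>Continual regression\<close>

theorem theorem11:
  fixes d T k :: nat and n :: "nat \<Rightarrow> nat"
    and X :: "nat \<Rightarrow> real mat" and y :: "nat \<Rightarrow> real Matrix.vec"
  defines "wstar \<equiv> min_norm_solution d T X y"
    and "R \<equiv> Max ((\<lambda>m. spectral_norm (X m)) ` {1..T})"
    and "rbar \<equiv> (\<Sum>m=1..T. real (mat_rank (X m))) / real T"
  assumes X: "\<And>m. m \<in> {1..T} \<Longrightarrow> X m \<in> carrier_mat (n m) d"
    and y: "\<And>m. m \<in> {1..T} \<Longrightarrow> y m \<in> carrier_vec (n m)"
    and realizable: "joint_solutions d T X y \<noteq> {}"
    and k: "k \<in> {2..T}"
  shows "measure_pmf.expectation (random_ordering T)
           (\<lambda>\<tau>. training_loss T X y (iterate d X y \<tau> k))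
         \<le> min (7 / root 4 (real k - 1)) ((real d - rbar + 1) / (real k - 1)) * (vnorm wstar)\<^sup>2 * R\<^sup>2
       \<and> measure_pmf.expectation (random_ordering T)
           (\<lambda>\<tau>. forgetting d X y \<tau> k)
         \<le> min (7 / root 4 (real k - 1)) ((real d - rbar + 1) / (real k - 1)) * (vnorm wstar)\<^sup>2 * R\<^sup>2"
proof -
  \<comment> \<open>Outside the tasks the identity serves as a filler, because the locale asks for a
    projection at every index.\<close>
  define P where "P m = (if m \<in> {1..T} then 1\<^sub>m d - pinv (X m) * X m else 1\<^sub>m d)" for m
  interpret proj_seq d P
  proof
    show "orth_proj d (P m)" for m
    proof (cases "m \<in> {1..T}")
      case True
      then show ?thesis
        unfolding P_def if_P[OF True] by (intro orth_proj_complement orth_proj_pinv_mult[OF X])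
    next
      case False
      then show ?thesis unfolding P_def if_not_P[OF False] by (intro orth_proj_one)
    qed
  qed
  define w where "w = wstar"
  have "w \<in> joint_solutions d T X y"
    unfolding w_def wstar_def by (rule min_norm_solution_mem[OF X realizable])
  then have wc: "w \<in> carrier_vec d" and sol: "\<And>m. m \<in> {1..T} \<Longrightarrow> X m *\<^sub>v w = y m"
    by (auto simp: joint_solutions_def)
  \<comment> \<open>The learner starts at 0, so the initial error is minus the solution.\<close>
  define v where "v = - w"
  have v: "v \<in> carrier_vec d" using wc by (simp add: v_def)
  have Tpos: "0 < T" using k by auto
  have tau: "\<tau> t \<in> {1..T}" if "\<tau> \<in> perms T" "t \<in> {1..T}" for \<tau> t
    using that permutes_in_image[of \<tau> "{1..T}" t] by (simp add: perms_def)
  have minus_minus_commute: "a - b - c = a - c - b" and minus_minus_cancel: "a - (a - b) = b"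
    if "a \<in> carrier_vec d" "b \<in> carrier_vec d" "c \<in> carrier_vec d" for a b c :: "real Matrix.vec"
    using that by (auto intro!: eq_vecI)
  \<comment> \<open>The residual of the error is the Kaczmarz correction itself.\<close>
  have res_eq: "res m e = pinv (X m) *\<^sub>v (X m *\<^sub>v e)" if "m \<in> {1..T}" "e \<in> carrier_vec d" for m e
  proof -
    define q where "q = pinv (X m) *\<^sub>v (X m *\<^sub>v e)"
    have q: "q \<in> carrier_vec d" "(pinv (X m) * X m) *\<^sub>v e = q"
      using pinv_carrier[OF X[OF that(1)]] X[OF that(1)] that(2)
      by (auto simp: q_def assoc_mult_mat_vec[of _ d "n m" _ d] intro!: mult_mat_vec_carrier)
    have "P m *\<^sub>v e = 1\<^sub>m d *\<^sub>v e - (pinv (X m) * X m) *\<^sub>v e"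
      unfolding P_def using that X[OF that(1)]
      by (simp add: minus_mult_distrib_mat_vec[OF one_carrier_mat pinv_mult_carrier[OF X[OF that(1)]]])
    then have "P m *\<^sub>v e = e - q" using q that by simp
    then show ?thesis
      unfolding res_def q_def[symmetric] using minus_minus_cancel[OF that(2) q(1) wc] by simp
  qed
  \<comment> \<open>Since \<open>y m = X m *\<^sub>v w\<close>, subtracting \<open>w\<close> turns
    the affine update into a projection of the error.\<close>
  have iterate: "iterate d X y \<tau> t \<in> carrier_vec d \<and> iterate d X y \<tau> t - w = err v \<tau> t"
    if "\<tau> \<in> perms T" "t \<le> T" for \<tau> t
    using that(2)
  proof (induction t)
    case 0
    then show ?case using wc v by (simp add: err_0 v_def uminus_l_inv_vec minus_add_uminus_vec[of _ d])
  next
    case (Suc t)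
    define m where "m = \<tau> (Suc t)"
    define u where "u = iterate d X y \<tau> t"
    have m: "m \<in> {1..T}" unfolding m_def using Suc.prems by (intro tau[OF that(1)]) auto
    have u: "u \<in> carrier_vec d" and e: "u - w = err v \<tau> t"
      using Suc by (auto simp: u_def)
    have ec: "u - w \<in> carrier_vec d" using u wc by simp
    have "X m *\<^sub>v u - y m = X m *\<^sub>v (u - w)"
      using mult_minus_distrib_mat_vec[OF X[OF m] u wc] sol[OF m] by simp
    then have step: "iterate d X y \<tau> (Suc t) = u - res m (u - w)"
      using res_eq[OF m ec] by (simp add: u_def m_def Let_def)
    have rc: "res m (u - w) \<in> carrier_vec d" using ec by simp
    have "u - res m (u - w) - w = (u - w) - res m (u - w)"
      using minus_minus_commute[OF u rc wc] .
    also have "\<dots> = P m *\<^sub>v (u - w)"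
      unfolding res_def by (rule minus_minus_cancel[OF ec P_mult_carrier[OF ec] wc])
    finally show ?case
      using step u rc by (simp add: err_Suc[OF v] e m_def)
  qed
  have R_ge: "spectral_norm (X m) \<le> R" if "m \<in> {1..T}" for m
    unfolding R_def using that by (intro Max_ge) auto
  \<comment> \<open>By the first Penrose condition \<open>X m\<close> sees only the residual part of
    the error.\<close>
  have loss: "(vnorm (X m *\<^sub>v iterate d X y \<tau> k - y m))\<^sup>2 \<le> R\<^sup>2 * sqn (res m (err v \<tau> k))"
    if "\<tau> \<in> perms T" "m \<in> {1..T}" for \<tau> m
  proof -
    define u where "u = iterate d X y \<tau> k"
    have u: "u \<in> carrier_vec d" "u - w = err v \<tau> k"
      using iterate[OF that(1), of k] k by (auto simp: u_def)
    define e where "e = u - w"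
    have e: "e \<in> carrier_vec d" unfolding e_def by (rule minus_carrier_vec[OF u(1) wc])
    note Xm = X[OF that(2)]
    have "X m *\<^sub>v u - y m = X m *\<^sub>v e"
      using mult_minus_distrib_mat_vec[OF Xm u(1) wc] sol[OF that(2)] by (simp add: e_def)
    also have "\<dots> = (X m * pinv (X m) * X m) *\<^sub>v e"
      using is_pinv_pinv[OF Xm] by (simp add: is_pinv_def)
    also have "\<dots> = X m *\<^sub>v res m e"
      using Xm e pinv_carrier[OF Xm] unfolding res_eq[OF that(2) e]
      by (simp add: assoc_mult_mat_vec[of "X m * pinv (X m)" "n m" "n m" "X m" d]
          assoc_mult_mat_vec[of "X m" "n m" d "pinv (X m)" "n m"])
    finally have "(vnorm (X m *\<^sub>v u - y m))\<^sup>2 = sqn (X m *\<^sub>v res m e)" by simp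
    also have "\<dots> \<le> (spectral_norm (X m))\<^sup>2 * sqn (res m e)"
      using e by (intro sqn_mult_le_spectral_norm[OF Xm]) simp
    also have "\<dots> \<le> R\<^sup>2 * sqn (res m e)"
      using R_ge[OF that(2)] spectral_norm_nonneg by (intro mult_right_mono power_mono) auto
    finally show ?thesis using u by (simp add: u_def e_def)
  qed
  define C where "C = min (7 / root 4 (real k - 1)) ((real d - rbar + 1) / (real k - 1)) * sqn v"
  \<comment> \<open>Averaging over the tasks turns the trace term of the rates into
    \<open>d - rbar\<close>.\<close>
  have "frob (P m) = real d - real (mat_rank (X m))" if "m \<in> {1..T}" for m
    using frob_complement_pinv[OF X[OF that]] that by (simp add: P_def)
  then have "(\<Sum>m=1..T. frob (P m)) = (\<Sum>m=1..T. real d - real (mat_rank (X m)))"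
    by (rule sum.cong[OF refl])
  then have tr: "(\<Sum>m=1..T. frob (P m)) / real T = real d - rbar"
    using Tpos by (simp add: rbar_def sum_subtractf diff_divide_distrib)
  have k': "2 \<le> k" "k \<le> T" using k by auto
  note rates = rate_bounds[OF v k', unfolded tr, folded C_def]
  note sums = sum_avg_res_le[OF v k' rates]
  have "measure_pmf.expectation (random_ordering T) (\<lambda>\<tau>. training_loss T X y (iterate d X y \<tau> k))
      \<le> avg T (\<lambda>\<tau>. R\<^sup>2 / (2 * real T) * (\<Sum>t=1..T. sqn (res (\<tau> t) (err v \<tau> k))))"
    unfolding expectation_random_ordering
  proof (rule avg_mono)
    fix \<tau> assume t: "\<tau> \<in> perms T"
    have "(\<Sum>m=1..T. (vnorm (X m *\<^sub>v iterate d X y \<tau> k - y m))\<^sup>2)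
        \<le> (\<Sum>m=1..T. R\<^sup>2 * sqn (res m (err v \<tau> k)))"
      using loss[OF t] by (rule sum_mono)
    \<comment> \<open>Tasks are renumbered by the position at which they occur, which separates seen
      from unseen ones.\<close>
    also have "\<dots> = R\<^sup>2 * (\<Sum>t=1..T. sqn (res (\<tau> t) (err v \<tau> k)))"
      unfolding sum_permuted[OF t, of "\<lambda>m. sqn (res m (err v \<tau> k))"] by (simp add: sum_distrib_left)
    finally show "training_loss T X y (iterate d X y \<tau> k)
        \<le> R\<^sup>2 / (2 * real T) * (\<Sum>t=1..T. sqn (res (\<tau> t) (err v \<tau> k)))"
      unfolding training_loss_def using Tpos by (simp add: divide_right_mono)
  qed
  also have "\<dots> = R\<^sup>2 / (2 * real T) * (\<Sum>t=1..T. avg T (\<lambda>\<tau>. sqn (res (\<tau> t) (err v \<tau> k))))"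
    by (simp only: avg_cmult avg_sum)
  also have "\<dots> \<le> R\<^sup>2 / (2 * real T) * (2 * real T * C)"
    using sums(2) by (intro mult_left_mono) auto
  also have "\<dots> = C * R\<^sup>2" using Tpos by simp
  finally have training: "measure_pmf.expectation (random_ordering T)
      (\<lambda>\<tau>. training_loss T X y (iterate d X y \<tau> k)) \<le> C * R\<^sup>2" .
  have "measure_pmf.expectation (random_ordering T) (\<lambda>\<tau>. forgetting d X y \<tau> k)
      \<le> avg T (\<lambda>\<tau>. R\<^sup>2 / (2 * real k) * (\<Sum>t=1..k. sqn (res (\<tau> t) (err v \<tau> k))))"
    unfolding expectation_random_ordering
  proof (rule avg_mono)
    fix \<tau> assume t: "\<tau> \<in> perms T"
    have "(\<Sum>t=1..k. (vnorm (X (\<tau> t) *\<^sub>v iterate d X y \<tau> k - y (\<tau> t)))\<^sup>2)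
        \<le> (\<Sum>t=1..k. R\<^sup>2 * sqn (res (\<tau> t) (err v \<tau> k)))"
      using k' by (intro sum_mono loss[OF t] tau[OF t]) auto
    also have "\<dots> = R\<^sup>2 * (\<Sum>t=1..k. sqn (res (\<tau> t) (err v \<tau> k)))"
      by (simp add: sum_distrib_left)
    finally show "forgetting d X y \<tau> k
        \<le> R\<^sup>2 / (2 * real k) * (\<Sum>t=1..k. sqn (res (\<tau> t) (err v \<tau> k)))"
      unfolding forgetting_def using k' by (simp add: divide_right_mono)
  qed
  also have "\<dots> = R\<^sup>2 / (2 * real k) * (\<Sum>t=1..k. avg T (\<lambda>\<tau>. sqn (res (\<tau> t) (err v \<tau> k))))"
    by (simp only: avg_cmult avg_sum)
  also have "\<dots> \<le> R\<^sup>2 / (2 * real k) * (2 * real k * C)"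
    using sums(1) by (intro mult_left_mono) auto
  also have "\<dots> = C * R\<^sup>2" using k' by simp
  finally have forgetting: "measure_pmf.expectation (random_ordering T)
      (\<lambda>\<tau>. forgetting d X y \<tau> k) \<le> C * R\<^sup>2" .
  have "sqn v = (vnorm wstar)\<^sup>2" by (simp add: v_def w_def)
  then show ?thesis using training forgetting by (simp add: C_def)
qed

end
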